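(* Any open planar convex polygon $K\subset\mathbb{R}^2$, given as the intersection of $n$ halfplanes, can be preprocessed in $O(n\log n)$ time into a data structure of size $O(n)$ that supports an algorithm which answers the exact depth query for $K$ in $O(n^3)$ time, for any query point $q\in\mathbb{R}^2$. That is, for every $q\in\mathbb{R}^2$ the algorithm returns the exact value $D_K(q)$. The implied constants are absolute.
   Context: An open planar convex polygon is a nonempty, bounded, open convex set in $\mathbb{R}^2$ that is an intersection of finitely many open halfplanes. $|S|$ denotes area. The halfspace depth of $q\in\mathbb{R}^2$ with respect to $K$ is $$D_K(q)=\inf\left\{\frac{|\{z\in K:\langle v,z-q\rangle\ge0\}|}{|K|}: v\in\mathbb{R}^2,\ \|v\|=1\right\}.$$ The exact depth query for $K$ asks, given $q\in\mathbb{R}^2$, for the value $D_K(q)$. Time is the number of elementary operations (exact arithmetic operations and comparisons on real numbers, memory accesses), and size is the number of real numbers/pointers stored. *)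

theory Defs
  imports "HOL-Analysis.Analysis"
begin

section \<open>Open convex polygons and halfspace depth\<close>

text \<open>A pair \<open>(a, c)\<close> with \<open>a \<noteq> 0\<close> encodes an open halfplane.\<close>

definition halfplane :: "(real^2) \<times> real \<Rightarrow> (real^2) set" where
  "halfplane h = {z. fst h \<bullet> z < snd h}"

definition open_halfplane :: "(real^2) set \<Rightarrow> bool" where
  "open_halfplane H \<longleftrightarrow> (\<exists>a c. a \<noteq> 0 \<and> H = halfplane (a, c))"

definition open_convex_polygon :: "(real^2) set \<Rightarrow> bool" where
  "open_convex_polygon K \<longleftrightarrow>
     K \<noteq> {} \<and> bounded K \<and> open K \<and> convex K \<and>
     (\<exists>\<H>. finite \<H> \<and> (\<forall>H\<in>\<H>. open_halfplane H) \<and> K = \<Inter>\<H>)"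

text \<open>The list may contain redundant and repeated halfplanes, in any order.\<close>

definition given_by :: "(real^2) set \<Rightarrow> ((real^2) \<times> real) list \<Rightarrow> bool" where
  "given_by K hs \<longleftrightarrow> (\<forall>h\<in>set hs. fst h \<noteq> 0) \<and> K = (\<Inter>h\<in>set hs. halfplane h)"

definition halfspace_depth :: "(real^2) set \<Rightarrow> real^2 \<Rightarrow> real" where
  "halfspace_depth K q =
     Inf {measure lebesgue {z \<in> K. v \<bullet> (z - q) \<ge> 0} / measure lebesgue K | v. norm v = 1}"


section \<open>A real random access machine\<close>

text \<open>
  Programs are finite syntax trees of a while language over scalar variables and arrays, both of
  two sorts: exact reals, and indices (natural numbers used for counting and addressing).
  Variables and arrays are named by fixed numbers occurring in the program text; arrays are
  unbounded, and a computed index selects a cell. Reals never influence indices except through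
  comparisons, so there is no floor function. Only integer constants are allowed, and index
  arithmetic is limited to addition and truncated subtraction: there is no unit-cost
  multiplication, division or bit manipulation of large integers.
\<close>

datatype iexp =
    IConst nat
  | IVar nat
  | IRead nat iexp
  | IAdd iexp iexp
  | ISub iexp iexp

datatype rexp =
    RConst int
  | RVar nat
  | RRead nat iexp
  | RAdd rexp rexp
  | RSub rexp rexp
  | RMul rexp rexp
  | RDiv rexp rexp

datatype bexp =
    ILess iexp iexp
  | RLess rexp rexp
  | BNot bexp
  | BAnd bexp bexp

datatype com =
    Skip
  | IAssign nat iexp
  | RAssign nat rexp
  | IWrite nat iexp iexp
  | RWrite nat iexp rexp
  | Seq com com
  | Cond bexp com com
  | While bexp com

record state =
  ivar :: "nat \<Rightarrow> nat"
  rvar :: "nat \<Rightarrow> real"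
  iarr :: "nat \<Rightarrow> nat \<Rightarrow> nat"
  rarr :: "nat \<Rightarrow> nat \<Rightarrow> real"

fun ival :: "iexp \<Rightarrow> state \<Rightarrow> nat" where
  "ival (IConst k) s = k"
| "ival (IVar x) s = ivar s x"
| "ival (IRead a e) s = iarr s a (ival e s)"
| "ival (IAdd e f) s = ival e s + ival f s"
| "ival (ISub e f) s = ival e s - ival f s"

text \<open>Division by zero yields \<open>0\<close>, as in HOL; a program can test for it with two comparisons.\<close>

fun rval :: "rexp \<Rightarrow> state \<Rightarrow> real" where
  "rval (RConst k) s = of_int k"
| "rval (RVar x) s = rvar s x"
| "rval (RRead a e) s = rarr s a (ival e s)"
| "rval (RAdd e f) s = rval e s + rval f s"
| "rval (RSub e f) s = rval e s - rval f s"
| "rval (RMul e f) s = rval e s * rval f s"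
| "rval (RDiv e f) s = rval e s / rval f s"

fun bval :: "bexp \<Rightarrow> state \<Rightarrow> bool" where
  "bval (ILess e f) s \<longleftrightarrow> ival e s < ival f s"
| "bval (RLess e f) s \<longleftrightarrow> rval e s < rval f s"
| "bval (BNot b) s \<longleftrightarrow> \<not> bval b s"
| "bval (BAnd b c) s \<longleftrightarrow> bval b s \<and> bval c s"

text \<open>Evaluating an expression costs one unit for every node, i.e. for every constant, memory
  access, arithmetic operation, comparison and Boolean connective.\<close>

fun icost :: "iexp \<Rightarrow> nat" where
  "icost (IConst k) = 1"
| "icost (IVar x) = 1"
| "icost (IRead a e) = 1 + icost e"
| "icost (IAdd e f) = 1 + icost e + icost f"
| "icost (ISub e f) = 1 + icost e + icost f"

fun rcost :: "rexp \<Rightarrow> nat" where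
  "rcost (RConst k) = 1"
| "rcost (RVar x) = 1"
| "rcost (RRead a e) = 1 + icost e"
| "rcost (RAdd e f) = 1 + rcost e + rcost f"
| "rcost (RSub e f) = 1 + rcost e + rcost f"
| "rcost (RMul e f) = 1 + rcost e + rcost f"
| "rcost (RDiv e f) = 1 + rcost e + rcost f"

fun bcost :: "bexp \<Rightarrow> nat" where
  "bcost (ILess e f) = 1 + icost e + icost f"
| "bcost (RLess e f) = 1 + rcost e + rcost f"
| "bcost (BNot b) = 1 + bcost b"
| "bcost (BAnd b c) = 1 + bcost b + bcost c"

text \<open>\<open>exec c s t s'\<close>: started in state \<open>s\<close>, the program \<open>c\<close> terminates in state \<open>s'\<close> after
  \<open>t\<close> elementary operations.\<close>

inductive exec :: "com \<Rightarrow> state \<Rightarrow> nat \<Rightarrow> state \<Rightarrow> bool" where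
  Skip: "exec Skip s 1 s"
| IAssign: "exec (IAssign x e) s (1 + icost e) (s\<lparr>ivar := (ivar s)(x := ival e s)\<rparr>)"
| RAssign: "exec (RAssign x e) s (1 + rcost e) (s\<lparr>rvar := (rvar s)(x := rval e s)\<rparr>)"
| IWrite: "exec (IWrite a i e) s (1 + icost i + icost e)
    (s\<lparr>iarr := (iarr s)(a := (iarr s a)(ival i s := ival e s))\<rparr>)"
| RWrite: "exec (RWrite a i e) s (1 + icost i + rcost e)
    (s\<lparr>rarr := (rarr s)(a := (rarr s a)(ival i s := rval e s))\<rparr>)"
| Seq: "exec c s t s' \<Longrightarrow> exec d s' u s'' \<Longrightarrow> exec (Seq c d) s (t + u) s''"
| CondTrue: "bval b s \<Longrightarrow> exec c s t s' \<Longrightarrow> exec (Cond b c d) s (1 + bcost b + t) s'"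
| CondFalse: "\<not> bval b s \<Longrightarrow> exec d s t s' \<Longrightarrow> exec (Cond b c d) s (1 + bcost b + t) s'"
| WhileFalse: "\<not> bval b s \<Longrightarrow> exec (While b c) s (1 + bcost b) s"
| WhileTrue: "bval b s \<Longrightarrow> exec c s t s' \<Longrightarrow> exec (While b c) s' u s'' \<Longrightarrow>
    exec (While b c) s (1 + bcost b + t + u) s''"

inductive_cases SkipE: "exec Skip s t s'"
inductive_cases IAssignE: "exec (IAssign x e) s t s'"
inductive_cases RAssignE: "exec (RAssign x e) s t s'"
inductive_cases IWriteE: "exec (IWrite a i e) s t s'"
inductive_cases RWriteE: "exec (RWrite a i e) s t s'"
inductive_cases SeqE: "exec (Seq c d) s t s'"
inductive_cases CondE: "exec (Cond b c d) s t s'"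
inductive_cases WhileE: "exec (While b c) s t s'"

text \<open>Execution is deterministic, so existence of a run determines the result and the time.\<close>

lemma exec_deterministic:
  "exec c s t s' \<Longrightarrow> exec c s u s'' \<Longrightarrow> u = t \<and> s'' = s'"
proof (induction arbitrary: u s'' rule: exec.induct)
  case Skip
  then show ?case by (rule SkipE) simp
next
  case IAssign
  then show ?case by (rule IAssignE) simp
next
  case RAssign
  then show ?case by (rule RAssignE) simp
next
  case IWrite
  then show ?case by (rule IWriteE) simp
next
  case RWrite
  then show ?case by (rule RWriteE) simp
next
  case Seq
  from Seq.prems show ?case by (rule SeqE) (auto dest!: Seq.IH)
next
  case CondTrue
  from CondTrue.prems show ?case by (rule CondE) (use CondTrue.hyps in \<open>auto dest!: CondTrue.IH\<close>)
next
  case CondFalse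
  from CondFalse.prems show ?case by (rule CondE) (use CondFalse.hyps in \<open>auto dest!: CondFalse.IH\<close>)
next
  case WhileFalse
  from WhileFalse.prems show ?case by (rule WhileE) (use WhileFalse.hyps in auto)
next
  case WhileTrue
  from WhileTrue.prems show ?case by (rule WhileE) (use WhileTrue.hyps in \<open>auto dest!: WhileTrue.IH\<close>)
qed


section \<open>Preprocessing and queries\<close>

text \<open>The input halfplanes \<open>{(x, y). a x + b y < c}\<close> are stored in the real arrays 0, 1, 2 and
  their number in the index variable 0; all other memory is zero.\<close>

definition prep_input :: "((real^2) \<times> real) list \<Rightarrow> state" where
  "prep_input hs =
     \<lparr>ivar = (\<lambda>_. 0)(0 := length hs),
      rvar = (\<lambda>_. 0),
      iarr = (\<lambda>_ _. 0),
      rarr = (\<lambda>a i. if i < length hs then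
                      (if a = 0 then fst (hs ! i) $ 1
                       else if a = 1 then fst (hs ! i) $ 2
                       else if a = 2 then snd (hs ! i)
                       else 0)
                    else 0)\<rparr>"

text \<open>A data structure is a block of reals and a block of pointers, the latter being addresses
  within the structure (the value one past the end serves as a null pointer). Its size also counts
  the two block lengths.\<close>

type_synonym data_structure = "real list \<times> nat list"

definition ds_size :: "data_structure \<Rightarrow> nat" where
  "ds_size D = length (fst D) + length (snd D) + 2"

definition pointers_valid :: "data_structure \<Rightarrow> bool" where
  "pointers_valid D \<longleftrightarrow> (\<forall>p\<in>set (snd D). p \<le> length (fst D) + length (snd D))"

text \<open>Preprocessing leaves the two blocks at the start of the real array 0 and of the index array 0,
  and their lengths in the index variables 0 and 1. Nothing else is passed on to the queries.\<close>

definition prep_output :: "state \<Rightarrow> data_structure" where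
  "prep_output s = (map (rarr s 0) [0..<ivar s 0], map (iarr s 0) [0..<ivar s 1])"

definition preprocesses :: "com \<Rightarrow> ((real^2) \<times> real) list \<Rightarrow> nat \<Rightarrow> data_structure \<Rightarrow> bool" where
  "preprocesses P hs t D \<longleftrightarrow>
     (\<exists>s. exec P (prep_input hs) t s \<and> D = prep_output s) \<and> pointers_valid D"

text \<open>A query finds the data structure in the same places, and the coordinates of the query point in
  the real variables 0 and 1. It returns its answer in the real variable 0.\<close>

definition query_input :: "data_structure \<Rightarrow> real^2 \<Rightarrow> state" where
  "query_input D q =
     \<lparr>ivar = (\<lambda>_. 0)(0 := length (fst D), 1 := length (snd D)),
      rvar = (\<lambda>_. 0)(0 := q $ 1, 1 := q $ 2),
      iarr = (\<lambda>a i. if a = 0 \<and> i < length (snd D) then snd D ! i else 0),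
      rarr = (\<lambda>a i. if a = 0 \<and> i < length (fst D) then fst D ! i else 0)\<rparr>"

definition answers :: "com \<Rightarrow> data_structure \<Rightarrow> real^2 \<Rightarrow> nat \<Rightarrow> real \<Rightarrow> bool" where
  "answers Q D q t r \<longleftrightarrow> (\<exists>s. exec Q (query_input D q) t s \<and> rvar s 0 = r)"

end

(*
  If q lies in K, then K - q = {z. u i . z < 1 for all i} with u i = a i / (c i - a i . q). Let F v be
  the area of the cap of K - q where v . z >= 0. Rotating v so that the endpoints of the chord through
  the origin stay on the edge lines i and j changes F by a difference of two triangle areas, whose
  sign is determined by the sense of rotation and by the sign of u i + u j on the chord. Hence F is monotone between neighbouring directions of the
  form +-u i +- u j, and F attains its minimum at one of these O(n^2) candidates; all of them are
  rational in the input. Since K - q is star-shaped about the origin, 2 F v is the sum over the edges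
  of the (suitably scaled) lengths of their parts in the cap, which costs O(n) per candidate once
  every edge has been clipped against all halfplanes. The preprocessing only has to store the input.
*)
theory Submission
  imports Defs
begin

text \<open>For a unit vector d, the ray along d meets the line \<open>u i \<bullet> z = 1\<close>
  at distance \<open>1 / (u i \<bullet> d)\<close>. The two halves of the chord along d thus have
  lengths 1/a and 1/b, where a and b are the maxima of \<open>u k \<bullet> d\<close> and
  \<open>u k \<bullet> (- d)\<close>. A small rotation sweeps areas proportional to the squares of
  these lengths, so inside an edge pair F can only be stationary where a = b, that is, where d is
  orthogonal to \<open>u i + u j\<close>; an end of the chord changes its edge only where d is
  orthogonal to some \<open>u i - u k\<close>. Finite triangles in place of derivatives keep the
  argument algebraic. Neither vertices nor a boundary order are computed, so redundant lines need no
  removal: their edges have length zero. Repeated lines would be counted several times and must be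
  recognised. Time is read off the program text: loops of at most 2n iterations, nested to depth 3,
  give the cubic bound.\<close>

section \<open>Running times of bounded loops\<close>

text \<open>The cost of a program all of whose loops make at most \<open>m\<close> iterations.\<close>

fun wcost :: "nat \<Rightarrow> com \<Rightarrow> nat" where
  "wcost m Skip = 1"
| "wcost m (IAssign x e) = 1 + icost e"
| "wcost m (RAssign x e) = 1 + rcost e"
| "wcost m (IWrite a i e) = 1 + icost i + icost e"
| "wcost m (RWrite a i e) = 1 + icost i + rcost e"
| "wcost m (Seq c d) = wcost m c + wcost m d"
| "wcost m (Cond b c d) = 1 + bcost b + (wcost m c + wcost m d)"
| "wcost m (While b c) = (m + 1) * (1 + bcost b) + m * wcost m c"

fun loop_depth :: "com \<Rightarrow> nat" where
  "loop_depth (Seq c d) = max (loop_depth c) (loop_depth d)"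
| "loop_depth (Cond b c d) = max (loop_depth c) (loop_depth d)"
| "loop_depth (While b c) = Suc (loop_depth c)"
| "loop_depth _ = 0"

text \<open>Separates the program from the input: \<open>wcost 1 c\<close> depends on the program
  text alone and becomes the absolute constant of the theorem.\<close>

lemma wcost_le_power:
  assumes "1 \<le> m"
  shows "wcost m c \<le> wcost 1 c * m ^ loop_depth c"
proof (induction c)
  case (Seq c d)
  have "m ^ loop_depth c \<le> m ^ loop_depth (Seq c d)" "m ^ loop_depth d \<le> m ^ loop_depth (Seq c d)"
    using assms by (auto intro!: power_increasing)
  then have "wcost 1 c * m ^ loop_depth c \<le> wcost 1 c * m ^ loop_depth (Seq c d)"
    "wcost 1 d * m ^ loop_depth d \<le> wcost 1 d * m ^ loop_depth (Seq c d)"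
    by (auto intro: mult_le_mono2)
  with Seq show ?case
    by (simp only: wcost.simps add_mult_distrib)
next
  case (Cond b c d)
  let ?p = "m ^ loop_depth (Cond b c d)"
  have "m ^ loop_depth c \<le> ?p" "m ^ loop_depth d \<le> ?p"
    using assms by (auto intro!: power_increasing)
  then have "wcost 1 c * m ^ loop_depth c \<le> wcost 1 c * ?p"
    "wcost 1 d * m ^ loop_depth d \<le> wcost 1 d * ?p"
    by (auto intro: mult_le_mono2)
  moreover have "1 \<le> ?p" using assms by (rule one_le_power)
  then have "1 + bcost b \<le> (1 + bcost b) * ?p"
    using mult_le_mono2[of 1 ?p "1 + bcost b"] by simp
  ultimately show ?case using Cond
    by (simp only: wcost.simps add_mult_distrib)
next
  case (While b c)
  let ?p = "m ^ loop_depth c"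
  \<comment> \<open>The guard is evaluated once more than the body; \<open>wcost 1\<close> of a loop
    counts the guard twice, which absorbs the factor 2.\<close>
  have "m + 1 \<le> 2 * (m * ?p)"
    using assms mult_le_mono2[OF one_le_power[OF assms], of m "loop_depth c"] by linarith
  then have "(m + 1) * (1 + bcost b) \<le> 2 * (m * ?p) * (1 + bcost b)"
    by (rule mult_le_mono1)
  moreover have "m * wcost m c \<le> m * (wcost 1 c * ?p)"
    using While by (rule mult_le_mono2)
  ultimately have "wcost m (While b c) \<le> 2 * (m * ?p) * (1 + bcost b) + m * (wcost 1 c * ?p)"
    unfolding wcost.simps by (rule add_mono)
  also have "\<dots> = wcost 1 (While b c) * m ^ loop_depth (While b c)"
    by (simp add: algebra_simps)
  finally show ?case .
qed (use assms in auto)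

text \<open>Total correctness with a time bound fixed by the program text. Invariants never mention
  time; only iteration counts have to stay below \<open>m\<close>.\<close>

definition run :: "nat \<Rightarrow> com \<Rightarrow> state \<Rightarrow> (state \<Rightarrow> bool) \<Rightarrow> bool" where
  "run m c s Q \<longleftrightarrow> (\<exists>t s'. exec c s t s' \<and> t \<le> wcost m c \<and> Q s')"

lemma run_Skip: "Q s \<Longrightarrow> run m Skip s Q"
  unfolding run_def using exec.Skip by fastforce

lemma run_IAssign: "Q (s\<lparr>ivar := (ivar s)(x := ival e s)\<rparr>) \<Longrightarrow> run m (IAssign x e) s Q"
  unfolding run_def using exec.IAssign by fastforce

lemma run_RAssign: "Q (s\<lparr>rvar := (rvar s)(x := rval e s)\<rparr>) \<Longrightarrow> run m (RAssign x e) s Q"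
  unfolding run_def using exec.RAssign by fastforce

lemma run_RWrite:
  "Q (s\<lparr>rarr := (rarr s)(a := (rarr s a)(ival i s := rval e s))\<rparr>) \<Longrightarrow> run m (RWrite a i e) s Q"
  unfolding run_def using exec.RWrite by fastforce

lemma run_Seq: "run m c s (\<lambda>s'. run m d s' Q) \<Longrightarrow> run m (Seq c d) s Q"
  unfolding run_def by (metis exec.Seq add_mono wcost.simps(6))

lemma run_Cond:
  assumes "bval b s \<Longrightarrow> run m c s Q" "\<not> bval b s \<Longrightarrow> run m d s Q"
  shows "run m (Cond b c d) s Q"
proof (cases "bval b s")
  case True
  with assms(1) obtain t s' where "exec c s t s'" "t \<le> wcost m c" "Q s'"
    by (auto simp: run_def)
  with True show ?thesis unfolding run_def
    by (intro exI[of _ "1 + bcost b + t"] exI[of _ s'] conjI exec.CondTrue) auto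
next
  case False
  with assms(2) obtain t s' where "exec d s t s'" "t \<le> wcost m d" "Q s'"
    by (auto simp: run_def)
  with False show ?thesis unfolding run_def
    by (intro exI[of _ "1 + bcost b + t"] exI[of _ s'] conjI exec.CondFalse) auto
qed

definition For :: "nat \<Rightarrow> iexp \<Rightarrow> com \<Rightarrow> com" where
  "For x e c = Seq (IAssign x (IConst 0))
     (While (ILess (IVar x) e) (Seq c (IAssign x (IAdd (IVar x) (IConst 1)))))"

text \<open>The limit is re-evaluated in every round, so the invariant must pin its value to
  \<open>l\<close>. The increment lies outside \<open>c\<close>, so the body has to hand back the
  counter unchanged.\<close>

lemma run_For:
  assumes "l \<le> m"
    and init: "I 0 (s\<lparr>ivar := (ivar s)(x := 0)\<rparr>)"
    and var: "\<And>k s. I k s \<Longrightarrow> ivar s x = k \<and> ival e s = l"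
    and step: "\<And>k s. k < l \<Longrightarrow> I k s \<Longrightarrow> ivar s x = k \<Longrightarrow>
      run m c s (\<lambda>s'. ivar s' x = k \<and> I (Suc k) (s'\<lparr>ivar := (ivar s')(x := Suc k)\<rparr>))"
    and post: "\<And>s. I l s \<Longrightarrow> Q s"
  shows "run m (For x e c) s Q"
proof -
  let ?c = "Seq c (IAssign x (IAdd (IVar x) (IConst 1)))"
  let ?b = "ILess (IVar x) e"
  have "I k s \<Longrightarrow> k \<le> l \<Longrightarrow> \<exists>t s'. exec (While ?b ?c) s t s' \<and>
      t \<le> (l - k + 1) * (1 + bcost ?b) + (l - k) * wcost m ?c \<and> I l s'" for k s
  proof (induction "l - k" arbitrary: k s)
    case 0
    then have "k = l" "\<not> bval ?b s" using var[OF 0(2)] by simp_all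
    with exec.WhileFalse[of ?b s ?c] 0 show ?case by auto
  next
    case (Suc i)
    then have k: "k < l" "ivar s x = k" "bval ?b s" using var[OF Suc.prems(1)] by simp_all
    from step[OF k(1) Suc.prems(1) k(2)] obtain t s' where
      s': "exec c s t s'" "t \<le> wcost m c" "ivar s' x = k" "I (Suc k) (s'\<lparr>ivar := (ivar s')(x := Suc k)\<rparr>)"
      unfolding run_def by blast
    let ?s = "s'\<lparr>ivar := (ivar s')(x := Suc k)\<rparr>"
    have "exec (IAssign x (IAdd (IVar x) (IConst 1))) s' 4 ?s"
      using exec.IAssign[of x "IAdd (IVar x) (IConst 1)" s'] s'(3) by (simp add: numeral_eq_Suc)
    with s'(1) have body: "exec ?c s (t + 4) ?s" by (rule exec.Seq)
    have "i = l - Suc k" "Suc k \<le> l" using Suc.hyps k by auto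
    from Suc.hyps(1)[OF this(1) s'(4) this(2)] obtain u s'' where
      s'': "exec (While ?b ?c) ?s u s''"
      "u \<le> (l - Suc k + 1) * (1 + bcost ?b) + (l - Suc k) * wcost m ?c" "I l s''" by blast
    have "l - k = Suc (l - Suc k)" using k by simp
    then have "1 + bcost ?b + (t + 4) + u \<le> (l - k + 1) * (1 + bcost ?b) + (l - k) * wcost m ?c"
      using s''(2) s'(2) by simp
    with exec.WhileTrue[OF k(3) body s''(1)] s''(3) show ?case by blast
  qed
  from this[OF init] obtain t s' where
    "exec (While ?b ?c) (s\<lparr>ivar := (ivar s)(x := 0)\<rparr>) t s'"
    "t \<le> (l + 1) * (1 + bcost ?b) + l * wcost m ?c" "I l s'" by auto
  moreover have "exec (IAssign x (IConst 0)) s 2 (s\<lparr>ivar := (ivar s)(x := 0)\<rparr>)"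
    using exec.IAssign[of x "IConst 0" s] by (simp add: numeral_eq_Suc)
  moreover have "(l + 1) * (1 + bcost ?b) + l * wcost m ?c \<le> (m + 1) * (1 + bcost ?b) + m * wcost m ?c"
    using \<open>l \<le> m\<close> by (intro add_mono mult_le_mono1) auto
  ultimately show ?thesis unfolding run_def For_def using post
    by (intro exI[of _ "2 + t"] exI[of _ s'] conjI exec.Seq) auto
qed

section \<open>Areas of planar sectors\<close>

definition cross2 :: "real^2 \<Rightarrow> real^2 \<Rightarrow> real" where
  "cross2 x y = x $ 1 * y $ 2 - x $ 2 * y $ 1"

definition rot :: "real^2 \<Rightarrow> real^2" where
  "rot x = vector [- (x $ 2), x $ 1]"

lemma rot_nth [simp]: "rot x $ 1 = - (x $ 2)" "rot x $ 2 = x $ 1"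
  by (simp_all add: rot_def)

lemma inner_vec2: "x \<bullet> y = x $ 1 * y $ 1 + x $ 2 * y $ 2" for x y :: "real^2"
  by (simp add: inner_vec_def sum_2)

lemma vec2_eq_iff: "x = y \<longleftrightarrow> x $ 1 = y $ 1 \<and> x $ 2 = y $ 2" for x y :: "real^2"
  by (simp add: vec_eq_iff forall_2)

lemma measure_triangle_origin:
  "measure lebesgue (convex hull {0, x, y}) = \<bar>cross2 x y\<bar> / 2" for x y :: "real^2"
proof -
  have "compact (convex hull {0, x, y})"
    by (intro finite_imp_compact_convex_hull) auto
  then have "measure lebesgue (convex hull {0, x, y}) = measure lborel (convex hull {0, x, y})"
    by (simp add: compact_imp_closed borel_closed measure_completion)
  also have "\<dots> = \<bar>cross2 x y\<bar> / 2"
    by (subst content_triangle) (auto simp: cross2_def abs_minus_commute mult.commute)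
  finally show ?thesis .
qed

text \<open>Both generators lie on the truncating line, so the truncation reads \<alpha> + \<beta>
  \<le> 1, the barycentric condition for the triangle with a vertex at the origin.\<close>

lemma cone_truncated_eq_hull:
  fixes x y w :: "real^2"
  assumes "w \<bullet> x = 1" "w \<bullet> y = 1"
  shows "{\<alpha> *\<^sub>R x + \<beta> *\<^sub>R y |\<alpha> \<beta>. 0 \<le> \<alpha> \<and> 0 \<le> \<beta> \<and> w \<bullet> (\<alpha> *\<^sub>R x + \<beta> *\<^sub>R y) \<le> 1} = convex hull {0, x, y}"
  using assms by (simp add: convex_hull_3_alt inner_add_right)

lemma lmeasurable_triangle: "convex hull {0, x, y} \<in> lmeasurable" for x y :: "real^2"
  by (intro lmeasurable_compact finite_imp_compact_convex_hull) auto

lemma measure_Un_negligible_Int: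
  assumes "S \<in> lmeasurable" "T \<in> lmeasurable" "negligible (S \<inter> T)"
  shows "measure lebesgue (S \<union> T) = measure lebesgue S + measure lebesgue T"
  using measure_Un3[OF assms(1,2)] assms(3) by (simp add: negligible_imp_measure0)

section \<open>Caps of a polygon containing the origin\<close>

text \<open>With the origin strictly inside, every bounding line can be scaled to right-hand side 1.
  Repeated and redundant normals are allowed, as in the input.\<close>

locale polar_polygon =
  fixes u :: "nat \<Rightarrow> real^2" and n :: nat
  assumes nonzero: "i < n \<Longrightarrow> u i \<noteq> 0"
    and bounded_interior: "bounded {z. \<forall>i<n. u i \<bullet> z < 1}"
begin

text \<open>Otherwise the whole ray in direction \<open>d\<close> would stay in the polygon.\<close>

lemma ex_inner_pos:
  assumes "d \<noteq> 0"
  shows "\<exists>i<n. 0 < u i \<bullet> d"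
proof (rule ccontr)
  assume "\<not> ?thesis"
  then have *: "u i \<bullet> d \<le> 0" if "i < n" for i using that by force
  have "t *\<^sub>R d \<in> {z. \<forall>i<n. u i \<bullet> z < 1}" if "0 \<le> t" for t
    using * that by (auto intro: le_less_trans[OF mult_nonneg_nonpos])
  moreover obtain B where B: "0 < B" "\<And>z. z \<in> {z. \<forall>i<n. u i \<bullet> z < 1} \<Longrightarrow> norm z \<le> B"
    using bounded_interior unfolding bounded_pos by blast
  ultimately have "norm (((B + 1) / norm d) *\<^sub>R d) \<le> B"
    by (meson divide_nonneg_nonneg add_nonneg_nonneg less_imp_le norm_ge_zero zero_le_one)
  then show False using assms B(1) by simp
qed

lemma inner_pos_if_max:
  assumes "\<And>k. k < n \<Longrightarrow> u k \<bullet> d \<le> u i \<bullet> d" "d \<noteq> 0"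
  shows "0 < u i \<bullet> d"
  using ex_inner_pos[OF assms(2)] assms(1) by force

definition body :: "(real^2) set" where
  "body = {z. \<forall>k<n. u k \<bullet> z \<le> 1}"

definition cap :: "real^2 \<Rightarrow> (real^2) set" where
  "cap v = {z \<in> body. 0 \<le> v \<bullet> z}"

definition cap_area :: "real^2 \<Rightarrow> real" where
  "cap_area v = measure lebesgue (cap v)"

lemma compact_body: "compact body"
proof -
  have "body = (\<Inter>k<n. {z. u k \<bullet> z \<le> 1})" by (auto simp: body_def)
  then have "closed body" by (auto intro: closed_halfspace_le)
  moreover have "bounded body"
  proof (rule bounded_subset)
    \<comment> \<open>Halving a point of \<open>body\<close> makes all its inequalities
      strict.\<close>
    show "bounded ((\<lambda>z. 2 *\<^sub>R z) ` {z. \<forall>i<n. u i \<bullet> z < 1})"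
      using bounded_interior by (rule bounded_scaling)
    have "z = 2 *\<^sub>R ((1/2) *\<^sub>R z) \<and> (1/2) *\<^sub>R z \<in> {z. \<forall>i<n. u i \<bullet> z < 1}" if "z \<in> body" for z
    proof -
      have "u i \<bullet> z / 2 < 1" if "i < n" for i
        using \<open>z \<in> body\<close> that unfolding body_def by fastforce
      then show ?thesis by simp
    qed
    then show "body \<subseteq> (\<lambda>z. 2 *\<^sub>R z) ` {z. \<forall>i<n. u i \<bullet> z < 1}" by blast
  qed
  ultimately show ?thesis by (simp add: compact_eq_bounded_closed)
qed

lemma compact_cap: "compact (cap v)"
proof -
  have "cap v = body \<inter> {z. v \<bullet> z \<ge> 0}" by (auto simp: cap_def)
  then show ?thesis using compact_body closed_halfspace_ge[of 0 v] by auto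
qed

lemma lmeasurable_cap: "cap v \<in> lmeasurable"
  by (simp add: compact_cap lmeasurable_compact)

lemma cap_area_scale: "0 < c \<Longrightarrow> cap_area (c *\<^sub>R v) = cap_area v"
  by (simp add: cap_area_def cap_def zero_le_mult_iff)

lemma cap_area_le: "cap_area v \<le> cap_area 0"
  unfolding cap_area_def
  by (rule measure_mono_fmeasurable)
    (auto simp: cap_def lmeasurable_cap fmeasurableD compact_body lmeasurable_compact
      intro: fmeasurableD[OF lmeasurable_cap, unfolded cap_def])

lemma cap_area_nonneg: "0 \<le> cap_area v"
  by (simp add: cap_area_def)

lemma cap_area_open:
  "measure lebesgue {z. (\<forall>i<n. u i \<bullet> z < 1) \<and> 0 \<le> v \<bullet> z} = cap_area v"
  unfolding cap_area_def
proof (rule measure_negligible_symdiff[OF lmeasurable_cap])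
  have "negligible (\<Union>i<n. {z. u i \<bullet> z = 1})"
    using nonzero by (auto intro!: negligible_Union negligible_hyperplane)
  then show "negligible (cap v - {z. (\<forall>i<n. u i \<bullet> z < 1) \<and> 0 \<le> v \<bullet> z} \<union>
      ({z. (\<forall>i<n. u i \<bullet> z < 1) \<and> 0 \<le> v \<bullet> z} - cap v))"
    by (rule negligible_subset) (force simp: cap_def body_def)
qed

subsection \<open>The area of a cap as a sum over the edges\<close>

text \<open>The parameter is the inner product with \<open>rot (u i)\<close>; edges become real
  intervals that can be clipped.\<close>

definition edge_point :: "nat \<Rightarrow> real \<Rightarrow> real^2" where
  "edge_point i \<tau> = (1 / (u i \<bullet> u i)) *\<^sub>R (u i + \<tau> *\<^sub>R rot (u i))"

text \<open>Among equal normals only the first carries an edge, so a repeated halfplane adds no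
  area.\<close>

definition first_index :: "nat \<Rightarrow> bool" where
  "first_index i \<longleftrightarrow> (\<forall>k<i. u k \<noteq> u i)"

definition edge :: "nat \<Rightarrow> real set" where
  "edge i = {\<tau>. first_index i \<and> edge_point i \<tau> \<in> body}"

text \<open>The part of the cap in the cone over edge \<open>i\<close>, described by the active
  constraint instead of end points; coverage and overlaps are then easy to read off.\<close>

definition sector :: "real^2 \<Rightarrow> nat \<Rightarrow> (real^2) set" where
  "sector v i = {z. first_index i \<and> (\<forall>k<n. u k \<bullet> z \<le> u i \<bullet> z) \<and> u i \<bullet> z \<le> 1 \<and> 0 \<le> v \<bullet> z}"

lemma inner_edge_point:
  assumes "i < n"
  shows "u i \<bullet> edge_point i \<tau> = 1" "rot (u i) \<bullet> edge_point i \<tau> = \<tau>"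
    "cross2 (edge_point i a) (edge_point i b) = (b - a) / (u i \<bullet> u i)"
proof -
  have N: "u i \<bullet> u i \<noteq> 0" using nonzero[OF assms] by simp
  have [simp]: "u i \<bullet> rot (u i) = 0" "rot (u i) \<bullet> u i = 0" "rot (u i) \<bullet> rot (u i) = u i \<bullet> u i"
    by (simp_all add: inner_vec2)
  show "u i \<bullet> edge_point i \<tau> = 1" "rot (u i) \<bullet> edge_point i \<tau> = \<tau>"
    using N by (simp_all add: edge_point_def inner_add_right)
  have "cross2 (u i + a *\<^sub>R rot (u i)) (u i + b *\<^sub>R rot (u i)) = (b - a) * (u i \<bullet> u i)"
    by (simp add: cross2_def inner_vec2 algebra_simps)
  moreover have "cross2 (c *\<^sub>R x) (c *\<^sub>R y) = c * c * cross2 x y" for c x y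
    by (simp add: cross2_def algebra_simps)
  ultimately show "cross2 (edge_point i a) (edge_point i b) = (b - a) / (u i \<bullet> u i)"
    using N by (simp add: edge_point_def)
qed

lemma point_eq_edge_point:
  assumes "i < n" "u i \<bullet> z \<noteq> 0"
  shows "z = (u i \<bullet> z) *\<^sub>R edge_point i ((rot (u i) \<bullet> z) / (u i \<bullet> z))"
proof -
  have "(u i \<bullet> u i) *\<^sub>R z = (u i \<bullet> z) *\<^sub>R u i + (rot (u i) \<bullet> z) *\<^sub>R rot (u i)"
    by (simp add: vec2_eq_iff inner_vec2 algebra_simps)
  then have "z = (1 / (u i \<bullet> u i)) *\<^sub>R ((u i \<bullet> z) *\<^sub>R u i + (rot (u i) \<bullet> z) *\<^sub>R rot (u i))"
    using nonzero[OF assms(1)] by (metis inner_eq_zero_iff divide_inverse_commute mult.right_neutral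
        scaleR_left_imp_eq scaleR_one scaleR_scaleR right_inverse)
  then show ?thesis using assms(2)
    by (simp add: edge_point_def scaleR_add_right mult.commute)
qed

lemma sector_on_ray:
  assumes i: "i < n" and z: "z \<in> sector v i" "z \<noteq> 0"
  obtains s \<tau> where "0 < s" "z = s *\<^sub>R edge_point i \<tau>" "\<tau> \<in> edge i" "0 \<le> v \<bullet> edge_point i \<tau>"
proof -
  define s where "s = u i \<bullet> z"
  define \<tau> where "\<tau> = (rot (u i) \<bullet> z) / s"
  have s: "0 < s" using z inner_pos_if_max[of z i] by (auto simp: sector_def s_def)
  then have zs: "z = s *\<^sub>R edge_point i \<tau>"
    using point_eq_edge_point[OF i, of z] by (simp add: s_def \<tau>_def)
  have "u k \<bullet> edge_point i \<tau> \<le> 1" if "k < n" for k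
  proof -
    have "u k \<bullet> z \<le> s" using z(1) that by (simp add: sector_def s_def)
    then have "s * (u k \<bullet> edge_point i \<tau>) \<le> s * 1" by (subst (asm) zs) simp
    then show ?thesis using s by simp
  qed
  moreover have "0 \<le> v \<bullet> z" using z(1) by (simp add: sector_def)
  then have "0 \<le> v \<bullet> edge_point i \<tau>"
    by (subst (asm) zs) (use s in \<open>simp add: zero_le_mult_iff\<close>)
  ultimately show ?thesis
    using that[OF s zs] z(1) by (simp add: sector_def edge_def body_def)
qed

lemma sector_eq_hull:
  assumes i: "i < n" and interval: "edge i \<inter> {\<tau>. 0 \<le> v \<bullet> edge_point i \<tau>} = {a..b}" and "a \<le> b"
  shows "sector v i = convex hull {0, edge_point i a, edge_point i b}"
proof -
  let ?A = "edge_point i a" and ?B = "edge_point i b"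
  have "a \<in> edge i \<inter> {\<tau>. 0 \<le> v \<bullet> edge_point i \<tau>}" "b \<in> edge i \<inter> {\<tau>. 0 \<le> v \<bullet> edge_point i \<tau>}"
    using assms(2,3) by auto
  then have A: "first_index i" "\<And>k. k < n \<Longrightarrow> u k \<bullet> ?A \<le> 1" "0 \<le> v \<bullet> ?A"
    and B: "\<And>k. k < n \<Longrightarrow> u k \<bullet> ?B \<le> 1" "0 \<le> v \<bullet> ?B"
    by (auto simp: edge_def body_def)
  have "sector v i = {\<alpha> *\<^sub>R ?A + \<beta> *\<^sub>R ?B |\<alpha> \<beta>. 0 \<le> \<alpha> \<and> 0 \<le> \<beta> \<and> u i \<bullet> (\<alpha> *\<^sub>R ?A + \<beta> *\<^sub>R ?B) \<le> 1}"
  proof (intro equalityI subsetI)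
    fix z assume z: "z \<in> sector v i"
    show "z \<in> {\<alpha> *\<^sub>R ?A + \<beta> *\<^sub>R ?B |\<alpha> \<beta>. 0 \<le> \<alpha> \<and> 0 \<le> \<beta> \<and> u i \<bullet> (\<alpha> *\<^sub>R ?A + \<beta> *\<^sub>R ?B) \<le> 1}"
    proof (cases "z = 0")
      case True
      then show ?thesis by (auto intro!: exI[of _ 0])
    next
      case False
      then obtain s \<tau> where s: "0 < s" and zs: "z = s *\<^sub>R edge_point i \<tau>" and "\<tau> \<in> {a..b}"
        using sector_on_ray[OF i z] interval by (metis (mono_tags, lifting) IntI mem_Collect_eq)
      then have "\<tau> \<in> closed_segment a b" using \<open>a \<le> b\<close> by (simp add: closed_segment_eq_real_ivl)
      then obtain t where t: "0 \<le> t" "t \<le> 1" "\<tau> = (1 - t) * a + t * b"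
        by (auto simp: closed_segment_def)
      have "edge_point i \<tau> = (1 - t) *\<^sub>R ?A + t *\<^sub>R ?B"
        unfolding edge_point_def t(3) by (simp add: vec2_eq_iff algebra_simps diff_divide_distrib add_divide_distrib)
      then have "z = (s * (1 - t)) *\<^sub>R ?A + (s * t) *\<^sub>R ?B"
        using zs by (simp add: scaleR_add_right)
      moreover have "0 \<le> s * (1 - t)" "0 \<le> s * t" "u i \<bullet> z \<le> 1"
        using s t z by (auto simp: sector_def)
      ultimately show ?thesis by blast
    qed
  next
    fix z assume "z \<in> {\<alpha> *\<^sub>R ?A + \<beta> *\<^sub>R ?B |\<alpha> \<beta>. 0 \<le> \<alpha> \<and> 0 \<le> \<beta> \<and> u i \<bullet> (\<alpha> *\<^sub>R ?A + \<beta> *\<^sub>R ?B) \<le> 1}"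
    then obtain \<alpha> \<beta> where z: "z = \<alpha> *\<^sub>R ?A + \<beta> *\<^sub>R ?B" "0 \<le> \<alpha>" "0 \<le> \<beta>" "u i \<bullet> z \<le> 1"
      by blast
    have "u k \<bullet> z \<le> u i \<bullet> z" if "k < n" for k
      unfolding z(1) inner_add_right inner_scaleR_right inner_edge_point(1)[OF i]
      using A(2)[OF that] B(1)[OF that] z(2,3) by (intro add_mono mult_left_mono)
    moreover have "0 \<le> v \<bullet> z"
      using z(1-3) A(3) B(2) by (simp add: inner_add_right)
    ultimately show "z \<in> sector v i" using z(4) A(1) by (simp add: sector_def)
  qed
  also have "\<dots> = convex hull {0, ?A, ?B}"
    by (rule cone_truncated_eq_hull) (simp_all add: inner_edge_point i)
  finally show ?thesis .
qed

lemma sector_subset_origin: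
  assumes i: "i < n" and empty: "edge i \<inter> {\<tau>. 0 \<le> v \<bullet> edge_point i \<tau>} = {}"
  shows "sector v i \<subseteq> {0}"
proof (rule ccontr)
  assume "\<not> ?thesis"
  then obtain z where "z \<in> sector v i" "z \<noteq> 0" by blast
  then show False using sector_on_ray[OF i] empty by (metis (mono_tags, lifting) IntI emptyE mem_Collect_eq)
qed

lemma lmeasurable_sector:
  assumes "i < n"
  shows "sector v i \<in> lmeasurable"
proof -
  have "sector v i = {z. first_index i} \<inter> (\<Inter>k<n. {z. (u k - u i) \<bullet> z \<le> 0}) \<inter> {z. u i \<bullet> z \<le> 1} \<inter> {z. v \<bullet> z \<ge> 0}"
    by (auto simp: sector_def inner_diff_left)
  moreover have "closed {z. first_index i}" by (cases "first_index i") auto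
  ultimately have "closed (sector v i)"
    by (auto intro!: closed_Int closed_INT closed_halfspace_le closed_halfspace_ge)
  moreover have "sector v i \<subseteq> body" by (force simp: sector_def body_def)
  ultimately show ?thesis
    using compact_body by (intro lmeasurable_compact) (metis compact_Int_closed inf.absorb_iff2)
qed

text \<open>Twice the area of a triangle at the origin is the cross product of its other two
  vertices, which for edge parameters is their difference over \<open>u i \<bullet> u i\<close>. The
  maximum with 0 covers the empty interval.\<close>

lemma measure_sector:
  assumes i: "i < n" and interval: "edge i \<inter> {\<tau>. 0 \<le> v \<bullet> edge_point i \<tau>} = {a..b}"
  shows "2 * measure lebesgue (sector v i) = max 0 (b - a) / (u i \<bullet> u i)"
proof (cases "a \<le> b")
  case True
  have "0 \<le> (b - a) / (u i \<bullet> u i)" using True by simp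
  then have "2 * (\<bar>(b - a) / (u i \<bullet> u i)\<bar> / 2) = (b - a) / (u i \<bullet> u i)"
    by (simp only: abs_of_nonneg) (simp only: times_divide_eq_right[symmetric] field_sum_of_halves mult_2)
  then show ?thesis using True
    by (simp only: sector_eq_hull[OF assms True] measure_triangle_origin inner_edge_point(3)[OF i]) simp
next
  case False
  then have "sector v i \<subseteq> {0}" using sector_subset_origin[OF i] interval by simp
  then have "negligible (sector v i)" by (rule negligible_subset[OF negligible_sing])
  then show ?thesis using False by (simp add: negligible_imp_measure0)
qed

lemma ex_inner_max:
  assumes "0 < n"
  obtains i where "i < n" "first_index i" "\<And>k. k < n \<Longrightarrow> u k \<bullet> z \<le> u i \<bullet> z"
proof -
  have fin: "finite ((\<lambda>k. u k \<bullet> z) ` {..<n})" "(\<lambda>k. u k \<bullet> z) ` {..<n} \<noteq> {}" using assms by auto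
  from Max_in[OF this] obtain j where j: "j < n" "Max ((\<lambda>k. u k \<bullet> z) ` {..<n}) = u j \<bullet> z" by auto
  \<comment> \<open>The maximiser \<open>j\<close> may be a repetition; the first copy attains the
    same value.\<close>
  define i where "i = (LEAST i. u i = u j)"
  have i: "u i = u j" unfolding i_def by (rule LeastI) (rule refl)
  have "i \<le> j" unfolding i_def by (rule Least_le) (rule refl)
  moreover have "first_index i" unfolding first_index_def
    using i not_less_Least[of _ "\<lambda>i. u i = u j"] unfolding i_def by metis
  moreover have "u k \<bullet> z \<le> u i \<bullet> z" if "k < n" for k
    using Max_ge[OF fin(1), of "u k \<bullet> z"] that i j(2) by auto
  ultimately show ?thesis using that[of i] j(1) by simp
qed

lemma n_ge_2: "2 \<le> n"
proof -
  have "axis 1 1 \<noteq> (0::real^2)" by (simp add: axis_eq_0_iff)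
  from ex_inner_pos[OF this] obtain i where i: "i < n" by blast
  from ex_inner_pos[of "- u i"] nonzero[OF i] obtain j where "j < n" "0 < u j \<bullet> (- u i)" by auto
  moreover from this have "j \<noteq> i" by (metis inner_ge_zero inner_minus_right neg_0_less_iff_less not_less)
  ultimately show ?thesis using i by linarith
qed

text \<open>Each point lies in the sector of a normal that is maximal there. Sectors of different
  normals meet on a null line; of equal normals, at most the first has a nonempty sector.\<close>

lemma cap_area_eq_sum:
  "cap_area v = (\<Sum>i<n. measure lebesgue (sector v i))"
proof -
  have "cap v = (\<Union>i\<in>{..<n}. sector v i)"
  proof (intro equalityI subsetI)
    fix z assume z: "z \<in> cap v"
    obtain i where "i < n" "first_index i" "\<And>k. k < n \<Longrightarrow> u k \<bullet> z \<le> u i \<bullet> z"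
      using ex_inner_max n_ge_2 by (metis less_le_trans zero_less_numeral)
    then have "z \<in> sector v i" using z by (auto simp: sector_def cap_def body_def)
    with \<open>i < n\<close> show "z \<in> (\<Union>i\<in>{..<n}. sector v i)" by blast
  qed (force simp: sector_def cap_def body_def)
  moreover have "negligible (sector v i \<inter> sector v j)" if "i < n" "j < n" "i \<noteq> j" for i j
  proof (cases "u i = u j")
    case True
    then have "sector v i \<inter> sector v j = {}"
      using that(3) by (auto simp: sector_def first_index_def) (metis nat_neq_iff)
    then show ?thesis by simp
  next
    case False
    have "sector v i \<inter> sector v j \<subseteq> {z. (u i - u j) \<bullet> z = 0}"
      using that by (auto simp: sector_def inner_diff_left intro: order_antisym)
    moreover have "negligible {z. (u i - u j) \<bullet> z = 0}"
      using False by (intro negligible_hyperplane) simp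
    ultimately show ?thesis by (rule negligible_subset[rotated])
  qed
  ultimately show ?thesis unfolding cap_area_def
    by (simp only:) (intro measure_negligible_finite_Union_image; simp add: lmeasurable_sector pairwise_def)
qed

subsection \<open>Rotating the cutting line\<close>

text \<open>The rays along \<open>rot v\<close> and \<open>rot v'\<close> both leave the body
  through line \<open>j\<close>, so this line alone cuts the wedge between them down to a
  triangle.\<close>

lemma body_sector_measure:
  fixes v v' :: "real^2"
  assumes j: "j < n" and min: "\<And>k. k < n \<Longrightarrow> cross2 (u j) v \<le> cross2 (u k) v"
    "\<And>k. k < n \<Longrightarrow> cross2 (u j) v' \<le> cross2 (u k) v'" and pos: "0 < cross2 v v'"
  shows "{z \<in> body. v \<bullet> z \<le> 0 \<and> 0 \<le> v' \<bullet> z} \<in> lmeasurable"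
    "2 * measure lebesgue {z \<in> body. v \<bullet> z \<le> 0 \<and> 0 \<le> v' \<bullet> z}
      = cross2 v v' / (cross2 (u j) v * cross2 (u j) v')"
proof -
  have cr: "cross2 w x = w \<bullet> (- rot x)" for w x by (simp add: cross2_def inner_vec2)
  have nz: "v \<noteq> 0" "v' \<noteq> 0" using pos by (auto simp: cross2_def)
  have rot_nz: "rot x \<noteq> 0" if "x \<noteq> 0" for x using that by (auto simp: vec2_eq_iff)
  define a where "a = u j \<bullet> rot v"
  define b where "b = u j \<bullet> rot v'"
  have max: "u k \<bullet> rot v \<le> a" "u k \<bullet> rot v' \<le> b" if "k < n" for k
    using min[OF that] by (simp_all add: cr a_def b_def)
  have ab: "0 < a" "0 < b" unfolding a_def b_def
    by (rule inner_pos_if_max; use max rot_nz nz in \<open>simp add: a_def b_def\<close>)+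
  define x where "x = (1 / a) *\<^sub>R rot v"
  define y where "y = (1 / b) *\<^sub>R rot v'"
  have ux: "u j \<bullet> x = 1" "u j \<bullet> y = 1" using ab by (simp_all add: x_def y_def a_def b_def)
  have uk: "u k \<bullet> x \<le> 1" "u k \<bullet> y \<le> 1" if "k < n" for k
    using max[OF that] ab by (simp_all add: x_def y_def divide_le_eq)
  have "cross2 x y = cross2 v v' / (a * b)"
    by (simp add: x_def y_def cross2_def algebra_simps diff_divide_distrib)
  then have xy: "\<bar>cross2 x y\<bar> = cross2 v v' / (cross2 (u j) v * cross2 (u j) v')"
    using pos ab by (simp add: cr a_def b_def abs_mult)
  have vx: "v \<bullet> x = 0" "v' \<bullet> y = 0" "v \<bullet> y = - cross2 v v' / b" "v' \<bullet> x = cross2 v v' / a"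
    by (simp_all add: x_def y_def inner_vec2 cross2_def algebra_simps diff_divide_distrib)
  have "{z \<in> body. v \<bullet> z \<le> 0 \<and> 0 \<le> v' \<bullet> z}
      = {\<alpha> *\<^sub>R x + \<beta> *\<^sub>R y |\<alpha> \<beta>. 0 \<le> \<alpha> \<and> 0 \<le> \<beta> \<and> u j \<bullet> (\<alpha> *\<^sub>R x + \<beta> *\<^sub>R y) \<le> 1}"
  proof (intro equalityI subsetI)
    fix z assume z: "z \<in> {z \<in> body. v \<bullet> z \<le> 0 \<and> 0 \<le> v' \<bullet> z}"
    \<comment> \<open>Cramer's rule for the coordinates of \<open>z\<close> in the basis
      \<open>x\<close>, \<open>y\<close>.\<close>
    define \<alpha> where "\<alpha> = (v' \<bullet> z) * a / cross2 v v'"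
    define \<beta> where "\<beta> = - (v \<bullet> z) * b / cross2 v v'"
    have "cross2 v v' *\<^sub>R z = (v' \<bullet> z) *\<^sub>R rot v - (v \<bullet> z) *\<^sub>R rot v'"
      by (simp add: vec2_eq_iff inner_vec2 cross2_def algebra_simps)
    then have "(1 / cross2 v v') *\<^sub>R (cross2 v v' *\<^sub>R z) = \<alpha> *\<^sub>R x + \<beta> *\<^sub>R y"
      using ab by (simp add: \<alpha>_def \<beta>_def x_def y_def scaleR_diff_right)
    then have eq: "z = \<alpha> *\<^sub>R x + \<beta> *\<^sub>R y" using pos by simp
    moreover have "0 \<le> \<alpha>" using z ab pos by (simp add: \<alpha>_def)
    moreover have "0 \<le> \<beta>" using z ab pos
      by (auto simp: \<beta>_def intro!: divide_nonpos_pos mult_nonpos_nonneg)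
    moreover have "u j \<bullet> z \<le> 1" using z j by (simp add: body_def)
    ultimately show "z \<in> {\<alpha> *\<^sub>R x + \<beta> *\<^sub>R y |\<alpha> \<beta>. 0 \<le> \<alpha> \<and> 0 \<le> \<beta> \<and> u j \<bullet> (\<alpha> *\<^sub>R x + \<beta> *\<^sub>R y) \<le> 1}"
      by blast
  next
    fix z assume "z \<in> {\<alpha> *\<^sub>R x + \<beta> *\<^sub>R y |\<alpha> \<beta>. 0 \<le> \<alpha> \<and> 0 \<le> \<beta> \<and> u j \<bullet> (\<alpha> *\<^sub>R x + \<beta> *\<^sub>R y) \<le> 1}"
    then obtain \<alpha> \<beta> where z: "z = \<alpha> *\<^sub>R x + \<beta> *\<^sub>R y" "0 \<le> \<alpha>" "0 \<le> \<beta>" "u j \<bullet> z \<le> 1" by blast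
    have "u k \<bullet> z \<le> u j \<bullet> z" if "k < n" for k
      unfolding z(1) inner_add_right inner_scaleR_right ux
      using uk[OF that] z(2,3) by (intro add_mono mult_left_mono)
    then have "z \<in> body" using z(4) by (force simp: body_def)
    moreover have "v \<bullet> z \<le> 0" "0 \<le> v' \<bullet> z"
      using z(2,3) ab pos by (simp_all add: z(1) inner_add_right vx divide_nonneg_pos)
    ultimately show "z \<in> {z \<in> body. v \<bullet> z \<le> 0 \<and> 0 \<le> v' \<bullet> z}" by simp
  qed
  also have "\<dots> = convex hull {0, x, y}" using ux by (rule cone_truncated_eq_hull)
  finally have eq: "{z \<in> body. v \<bullet> z \<le> 0 \<and> 0 \<le> v' \<bullet> z} = convex hull {0, x, y}" .
  show "{z \<in> body. v \<bullet> z \<le> 0 \<and> 0 \<le> v' \<bullet> z} \<in> lmeasurable"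
    unfolding eq by (rule lmeasurable_triangle)
  show "2 * measure lebesgue {z \<in> body. v \<bullet> z \<le> 0 \<and> 0 \<le> v' \<bullet> z}
      = cross2 v v' / (cross2 (u j) v * cross2 (u j) v')"
    unfolding eq measure_triangle_origin xy by simp
qed

text \<open>The chord orthogonal to \<open>v\<close> through the origin ends on the edges \<open>i\<close> and \<open>j\<close>; rotating it to
  the chord orthogonal to \<open>v'\<close> adds a triangle at \<open>j\<close> and removes one at \<open>i\<close>.\<close>

lemma cap_area_rotate:
  fixes v v' :: "real^2"
  assumes i: "i < n" "\<And>k. k < n \<Longrightarrow> cross2 (u k) v \<le> cross2 (u i) v"
      "\<And>k. k < n \<Longrightarrow> cross2 (u k) v' \<le> cross2 (u i) v'"
    and j: "j < n" "\<And>k. k < n \<Longrightarrow> cross2 (u j) v \<le> cross2 (u k) v"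
      "\<And>k. k < n \<Longrightarrow> cross2 (u j) v' \<le> cross2 (u k) v'"
    and pos: "0 < cross2 v v'"
  shows "2 * (cap_area v' - cap_area v) =
    cross2 v v' / (cross2 (u j) v * cross2 (u j) v') - cross2 v v' / (cross2 (u i) v * cross2 (u i) v')"
proof -
  let ?G = "{z \<in> body. v \<bullet> z \<le> 0 \<and> 0 \<le> v' \<bullet> z}"
  let ?L = "{z \<in> body. v' \<bullet> z \<le> 0 \<and> 0 \<le> v \<bullet> z}"
  have neg: "cross2 x (- y) = - cross2 x y" "cross2 (- x) y = - cross2 x y" for x y
    by (simp_all add: cross2_def)
  \<comment> \<open>Negating both vectors makes the maximal index \<open>i\<close> minimal, so the
    same lemma measures the removed triangle.\<close>
  have L: "{z \<in> body. (- v) \<bullet> z \<le> 0 \<and> 0 \<le> (- v') \<bullet> z} = ?L" by auto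
  note G = body_sector_measure[OF j pos]
  note L = body_sector_measure[of i "- v" "- v'", OF i(1), unfolded L neg, simplified, OF i(2,3) pos]
  have nz: "v \<noteq> 0" "v' \<noteq> 0" using pos by (auto simp: cross2_def)
  have "measure lebesgue (cap v \<union> ?G) = cap_area v + measure lebesgue ?G"
    unfolding cap_area_def
  proof (intro measure_Un_negligible_Int lmeasurable_cap G(1))
    show "negligible (cap v \<inter> ?G)"
      by (rule negligible_subset[OF negligible_hyperplane[of v 0]]) (use nz in \<open>auto simp: cap_def\<close>)
  qed
  moreover have "measure lebesgue (cap v' \<union> ?L) = cap_area v' + measure lebesgue ?L"
    unfolding cap_area_def
  proof (intro measure_Un_negligible_Int lmeasurable_cap L(1))
    show "negligible (cap v' \<inter> ?L)"
      by (rule negligible_subset[OF negligible_hyperplane[of v' 0]]) (use nz in \<open>auto simp: cap_def\<close>)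
  qed
  moreover have "cap v \<union> ?G = cap v' \<union> ?L" by (auto simp: cap_def)
  ultimately have "cap_area v + measure lebesgue ?G = cap_area v' + measure lebesgue ?L" by simp
  then show ?thesis using G(2) L(2) by (simp add: algebra_simps)
qed

end

section \<open>Neighbouring critical directions\<close>

text \<open>Rotating \<open>v\<close> in the sense given by \<open>\<sigma>\<close> up to the first direction of \<open>W\<close>.\<close>

lemma ex_first_direction:
  fixes v :: "real^2" and \<sigma> :: real
  assumes W: "finite W" "W \<noteq> {}" "\<And>w. w \<in> W \<Longrightarrow> - w \<in> W" and \<sigma>: "\<sigma> \<noteq> 0"
    and generic: "\<And>w. w \<in> W \<Longrightarrow> cross2 w v \<noteq> 0"
  obtains v' where "v' \<in> W" "0 < \<sigma> * cross2 v v'"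
    "\<And>w. w \<in> W \<Longrightarrow> 0 < cross2 w v \<Longrightarrow> 0 \<le> cross2 w v'"
    "\<And>w. w \<in> W \<Longrightarrow> cross2 w v < 0 \<Longrightarrow> cross2 w v' \<le> 0"
proof -
  have anti: "cross2 x y = - cross2 y x" for x y by (simp add: cross2_def)
  have neg: "cross2 x (- y) = - cross2 x y" "cross2 (- x) y = - cross2 x y" for x y
    by (simp_all add: cross2_def)
  \<comment> \<open>On \<open>W'\<close> this is, up to a positive factor, the cotangent of the
    angle from \<open>v\<close> to \<open>w\<close> in the chosen sense; its maximum is the smallest
    rotation.\<close>
  define f where "f w = (v \<bullet> w) / (\<sigma> * cross2 v w)" for w
  define W' where "W' = {w \<in> W. 0 < \<sigma> * cross2 v w}"
  obtain w0 where w0: "w0 \<in> W" using W(2) by blast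
  have "w0 \<in> W' \<or> - w0 \<in> W'"
    using w0 W(3)[OF w0] generic[OF w0] \<sigma> anti[of w0 v]
    by (auto simp: W'_def neg zero_less_mult_iff not_less mult_less_0_iff)
  then have "W' \<noteq> {}" "finite W'" using W(1) by (auto simp: W'_def)
  then have fin: "finite (f ` W')" "f ` W' \<noteq> {}" by auto
  from Max_in[OF this] obtain v' where v': "v' \<in> W'" "Max (f ` W') = f v'" by auto
  have v'_max: "f w \<le> f v'" if "w \<in> W'" for w
    using Max_ge[OF fin(1), of "f w"] that v'(2) by simp
  have pos: "0 < \<sigma> * cross2 v v'" using v'(1) by (simp add: W'_def)
  have vv: "0 < v \<bullet> v" using pos by (auto simp: cross2_def)
  have *: "0 \<le> \<sigma> * (\<sigma> * cross2 w v')" if "w \<in> W" "0 < cross2 w v" for w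
  proof -
    \<comment> \<open>Reduces the sign of \<open>cross2 w v'\<close> to comparing the cotangent of
      \<open>v'\<close> with that of \<open>w\<close> or \<open>- w\<close>, whichever lies in
      \<open>W'\<close>.\<close>
    have id: "(v \<bullet> v) * cross2 w v' = cross2 w v * (v \<bullet> v') + (v \<bullet> w) * cross2 v v'"
      by (simp add: cross2_def inner_vec2 algebra_simps)
    have "0 \<le> (v \<bullet> v) * (\<sigma> * (\<sigma> * cross2 w v'))"
    proof (cases "0 < \<sigma>")
      case True
      then have "0 < \<sigma> * cross2 w v" using that by simp
      moreover from this have "- w \<in> W'" using that(1) W(3) by (simp add: W'_def neg anti[of v w])
      from v'_max[OF this] have "- (v \<bullet> w) / (\<sigma> * cross2 w v) \<le> (v \<bullet> v') / (\<sigma> * cross2 v v')"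
        by (simp add: f_def neg anti[of v w])
      ultimately have "- (v \<bullet> w) * (\<sigma> * cross2 v v') \<le> (v \<bullet> v') * (\<sigma> * cross2 w v)"
        using pos by (simp only: pos_divide_le_eq times_divide_eq_left pos_le_divide_eq)
      then have "0 \<le> \<sigma> * ((v \<bullet> v) * cross2 w v')"
        unfolding id by (simp add: algebra_simps)
      with True have "0 \<le> \<sigma> * (\<sigma> * ((v \<bullet> v) * cross2 w v'))" by simp
      then show ?thesis by (simp only: mult_ac)
    next
      case False
      then have neg_\<sigma>: "\<sigma> < 0" using \<sigma> by simp
      then have "0 < \<sigma> * cross2 v w" using that by (simp add: anti[of v w] mult_neg_pos)
      moreover from this have "w \<in> W'" using that by (simp add: W'_def)
      from v'_max[OF this] have "(v \<bullet> w) / (\<sigma> * cross2 v w) \<le> (v \<bullet> v') / (\<sigma> * cross2 v v')"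
        by (simp add: f_def)
      ultimately have "(v \<bullet> w) * (\<sigma> * cross2 v v') \<le> (v \<bullet> v') * (\<sigma> * cross2 v w)"
        using pos by (simp only: pos_divide_le_eq times_divide_eq_left pos_le_divide_eq)
      then have "\<sigma> * ((v \<bullet> v) * cross2 w v') \<le> 0"
        unfolding id by (simp add: anti[of v w] algebra_simps)
      with neg_\<sigma> have "0 \<le> \<sigma> * (\<sigma> * ((v \<bullet> v) * cross2 w v'))" by (intro mult_nonpos_nonpos) auto
      then show ?thesis by (simp only: mult_ac)
    qed
    with vv show ?thesis by (metis linorder_not_less mult_pos_neg)
  qed
  have **: "0 \<le> cross2 w v'" if "w \<in> W" "0 < cross2 w v" for w
  proof -
    have "0 < \<sigma> * \<sigma>" using \<sigma> by (metis not_real_square_gt_zero)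
    then show ?thesis using *[OF that] by (metis linorder_not_less mult.assoc mult_pos_neg)
  qed
  then have "cross2 w v' \<le> 0" if "w \<in> W" "cross2 w v < 0" for w
    using **[OF W(3)[OF that(1)]] that(2) by (simp add: neg)
  with ** pos v'(1) show ?thesis using that by (auto simp: W'_def)
qed

section \<open>The minimum over all directions is attained at a candidate\<close>

context polar_polygon
begin

definition signed_normal :: "nat \<Rightarrow> real^2" where
  "signed_normal i = (if i < n then u i else - u (i - n))"

lemma signed_normal_simps [simp]:
  "i < n \<Longrightarrow> signed_normal i = u i" "signed_normal (n + i) = - u i"
  by (simp_all add: signed_normal_def)

text \<open>Ordered pairs from the doubled list give all sign patterns in one double loop. The zero
  vector occurs too, but its cap is the whole body and cannot lower the minimum.\<close>

definition candidates :: "(real^2) set" where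
  "candidates = {signed_normal i + signed_normal j |i j. i < 2 * n \<and> j < 2 * n}"

lemma candidatesI:
  assumes "i < n" "j < n"
  shows "u i + u j \<in> candidates" "u i - u j \<in> candidates"
proof -
  have "u i + u j = signed_normal i + signed_normal j" "u i - u j = signed_normal i + signed_normal (n + j)"
    using assms by simp_all
  moreover have "i < 2 * n" "j < 2 * n" "n + j < 2 * n" using assms by auto
  ultimately show "u i + u j \<in> candidates" "u i - u j \<in> candidates"
    unfolding candidates_def by blast+
qed

lemma candidates_uminus:
  assumes "w \<in> candidates"
  shows "- w \<in> candidates"
proof -
  have *: "\<exists>k<2 * n. signed_normal k = - signed_normal i" if "i < 2 * n" for i
  proof (cases "i < n")
    case True
    then show ?thesis by (intro exI[of _ "n + i"]) simp
  next
    case False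
    then show ?thesis using that by (intro exI[of _ "i - n"]) (auto simp: signed_normal_def)
  qed
  from assms obtain i j where "w = signed_normal i + signed_normal j" "i < 2 * n" "j < 2 * n"
    by (auto simp: candidates_def)
  moreover from *[OF this(2)] *[OF this(3)] obtain k l
    where "k < 2 * n" "signed_normal k = - signed_normal i" "l < 2 * n" "signed_normal l = - signed_normal j"
    by blast
  ultimately have "- w = signed_normal k + signed_normal l \<and> k < 2 * n \<and> l < 2 * n" by simp
  then show ?thesis unfolding candidates_def by blast
qed

lemma finite_candidates: "finite candidates"
proof -
  have "candidates = (\<lambda>(i, j). signed_normal i + signed_normal j) ` ({..<2 * n} \<times> {..<2 * n})"
    by (auto simp: candidates_def)
  then show ?thesis by simp
qed

text \<open>The chord orthogonal to \<open>u i - u j\<close> passes through the intersection of the edge lines \<open>i\<close> and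
  \<open>j\<close>, and the origin bisects the segment that these lines cut off from the line orthogonal to
  \<open>u i + u j\<close>. Between two neighbouring such directions the area is monotone.\<close>

lemma ex_candidate_le:
  assumes "v \<noteq> 0"
  shows "\<exists>w\<in>candidates. w \<noteq> 0 \<and> cap_area w \<le> cap_area v"
proof (cases "\<exists>w\<in>candidates - {0}. cross2 w v = 0")
  case True
  then obtain w where w: "w \<in> candidates" "w \<noteq> 0" "cross2 w v = 0" by blast
  define c where "c = (v \<bullet> w) / (w \<bullet> w)"
  have "(w \<bullet> w) *\<^sub>R v = (v \<bullet> w) *\<^sub>R w + cross2 w v *\<^sub>R rot w"
    by (simp add: vec2_eq_iff inner_vec2 cross2_def algebra_simps)
  then have "(1 / (w \<bullet> w)) *\<^sub>R ((w \<bullet> w) *\<^sub>R v) = c *\<^sub>R w" by (simp add: w(3) c_def)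
  then have v: "v = c *\<^sub>R w" using w(2) by simp
  show ?thesis
  proof (cases "0 < c")
    case True
    then show ?thesis using w v by (auto simp: cap_area_scale)
  next
    case False
    then have "0 < - c" "v = (- c) *\<^sub>R (- w)" using v assms by (auto simp: not_less)
    then have "cap_area v = cap_area (- w)" by (metis cap_area_scale)
    moreover have "- w \<in> candidates" "- w \<noteq> 0" using w candidates_uminus by auto
    ultimately show ?thesis by (metis order_refl)
  qed
next
  case False
  have n: "0 < n" using n_ge_2 by simp
  have cr: "cross2 w x = w \<bullet> (- rot x)" for w x by (simp add: cross2_def inner_vec2)
  have rot_nz: "rot x \<noteq> 0" if "x \<noteq> 0" for x using that by (auto simp: vec2_eq_iff)
  have lin: "cross2 (x + y) z = cross2 x z + cross2 y z" "cross2 (x - y) z = cross2 x z - cross2 y z"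
    for x y z by (simp_all add: cross2_def algebra_simps)
  obtain i where i: "i < n" "\<And>k. k < n \<Longrightarrow> cross2 (u k) v \<le> cross2 (u i) v"
    using ex_inner_max[OF n, of "- rot v"] by (metis cr)
  obtain j where j: "j < n" "\<And>k. k < n \<Longrightarrow> cross2 (u j) v \<le> cross2 (u k) v"
    using ex_inner_max[OF n, of "rot v"] unfolding cr by (metis inner_minus_right neg_le_iff_le)
  \<comment> \<open>The compared value is \<open>a - b\<close> in the notation below, and the chord
    halves are proportional to 1/a and 1/b. The rotation goes in the sense in which the longer half
    sweeps area out of the cap.\<close>
  define \<sigma> :: real where "\<sigma> = (if cross2 (u i + u j) v \<le> 0 then 1 else - 1)"
  have fin: "finite (candidates - {0})" using finite_candidates by simp
  have "u i + u i \<in> candidates - {0}"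
    using candidatesI(1)[OF i(1) i(1)] nonzero[OF i(1)] by (simp add: scaleR_2[symmetric])
  then have ne: "candidates - {0} \<noteq> {}" by blast
  have sym: "- w \<in> candidates - {0}" if "w \<in> candidates - {0}" for w
    using that candidates_uminus by auto
  have \<sigma>: "\<sigma> \<noteq> 0" by (simp add: \<sigma>_def)
  have generic: "cross2 w v \<noteq> 0" if "w \<in> candidates - {0}" for w using False that by blast
  obtain v' where v': "v' \<in> candidates - {0}" "0 < \<sigma> * cross2 v v'"
    and keep_pos: "\<And>w. w \<in> candidates - {0} \<Longrightarrow> 0 < cross2 w v \<Longrightarrow> 0 \<le> cross2 w v'"
    and keep_neg: "\<And>w. w \<in> candidates - {0} \<Longrightarrow> cross2 w v < 0 \<Longrightarrow> cross2 w v' \<le> 0"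
    using ex_first_direction[OF fin ne sym \<sigma> generic] by metis
  have keep: "0 \<le> cross2 w v'" if "w \<in> candidates" "0 \<le> cross2 w v" for w
    using keep_pos[of w] generic[of w] that by (cases "w = 0") (auto simp: cross2_def)
  have keep': "cross2 w v' \<le> 0" if "w \<in> candidates" "cross2 w v \<le> 0" for w
    using keep_neg[of w] generic[of w] that by (cases "w = 0") (auto simp: cross2_def)
  \<comment> \<open>The differences \<open>u i - u k\<close> are candidates, so their signs persist
    up to \<open>v'\<close> and the chord still ends on the same edge lines.\<close>
  have i': "cross2 (u k) v' \<le> cross2 (u i) v'" if "k < n" for k
    using keep[OF candidatesI(2)[OF i(1) that]] i(2)[OF that] by (simp add: lin)
  have j': "cross2 (u j) v' \<le> cross2 (u k) v'" if "k < n" for k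
    using keep[OF candidatesI(2)[OF that j(1)]] j(2)[OF that] by (simp add: lin)
  have pos_i: "0 < cross2 (u i) x" if "x \<noteq> 0" "\<And>k. k < n \<Longrightarrow> cross2 (u k) x \<le> cross2 (u i) x" for x
    using inner_pos_if_max[of "- rot x" i] that rot_nz[of x] unfolding cr by simp
  have pos_j: "cross2 (u j) x < 0" if "x \<noteq> 0" "\<And>k. k < n \<Longrightarrow> cross2 (u j) x \<le> cross2 (u k) x" for x
    using inner_pos_if_max[of "rot x" j] that rot_nz[of x] unfolding cr by simp
  define a where "a = cross2 (u i) v"
  define a' where "a' = cross2 (u i) v'"
  define b where "b = - cross2 (u j) v"
  define b' where "b' = - cross2 (u j) v'"
  have ab: "0 < a" "0 < a'" "0 < b" "0 < b'"
    using pos_i[OF assms i(2)] pos_i[OF _ i'] pos_j[OF assms j(2)] pos_j[OF _ j'] v'(1)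
    by (simp_all add: a_def a'_def b_def b'_def)
  have "cap_area v' \<le> cap_area v"
  proof (cases "cross2 (u i + u j) v \<le> 0")
    case True
    then have pos: "0 < cross2 v v'" using v'(2) by (simp add: \<sigma>_def)
    \<comment> \<open>As \<open>u i + u j\<close> is a candidate as well, the order of the two
      halves persists up to \<open>v'\<close>; the lost triangle is at least as large as the gained
      one.\<close>
    have "a \<le> b" "a' \<le> b'"
      using True keep'[OF candidatesI(1)[OF i(1) j(1)] True] by (simp_all add: lin a_def b_def a'_def b'_def)
    then have "a * a' \<le> b * b'" using ab by (intro mult_mono) auto
    then have "cross2 v v' / (b * b') \<le> cross2 v v' / (a * a')"
      using ab pos by (intro divide_left_mono) auto
    then show ?thesis
      using cap_area_rotate[OF i(1,2) i' j(1,2) j' pos] by (simp add: a_def a'_def b_def b'_def)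
  next
    case False
    have "cross2 v v' = - cross2 v' v" by (simp add: cross2_def)
    then have pos: "0 < cross2 v' v" using False v'(2) by (simp add: \<sigma>_def)
    have "b \<le> a" "b' \<le> a'"
      using False keep[OF candidatesI(1)[OF i(1) j(1)]] by (simp_all add: lin a_def b_def a'_def b'_def)
    then have "b' * b \<le> a' * a" using ab by (intro mult_mono) auto
    then have "cross2 v' v / (a' * a) \<le> cross2 v' v / (b' * b)"
      using ab pos by (intro divide_left_mono) auto
    then show ?thesis
      using cap_area_rotate[OF i(1) i' i(2) j(1) j' j(2) pos] by (simp add: a_def a'_def b_def b'_def)
  qed
  with v'(1) show ?thesis by blast
qed

lemma cap_area_quotient_eq_Inf:
  assumes lower: "\<And>w. w \<in> candidates \<Longrightarrow> m \<le> cap_area w" and attained: "m = cap_area x"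
  shows "m / cap_area 0 = Inf {cap_area v / cap_area 0 |v. norm v = 1}"
proof -
  have le: "m \<le> cap_area v" if "v \<noteq> 0" for v
    using ex_candidate_le[OF that] lower by force
  have "\<exists>y. y \<noteq> 0 \<and> cap_area y = m"
  \<comment> \<open>The zero vector has no unit multiple. If it attains \<open>m\<close>, then
    \<open>m\<close> is the full area, and any nonzero normal attains it too.\<close>
  proof (cases "x = 0")
    case True
    obtain i where "i < n" using n_ge_2 by (metis less_le_trans zero_less_numeral)
    from nonzero[OF this] show ?thesis
      using le[of "u i"] cap_area_le[of "u i"] attained True by (auto intro!: exI[of _ "u i"])
  qed (use attained in blast)
  then obtain y where y: "y \<noteq> 0" "cap_area y = m" by blast
  define y' where "y' = (1 / norm y) *\<^sub>R y"
  have y': "norm y' = 1" "cap_area y' = m" using y by (simp_all add: y'_def cap_area_scale)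
  show ?thesis
  proof (rule cInf_eq_minimum[symmetric])
    show "m / cap_area 0 \<in> {cap_area v / cap_area 0 |v. norm v = 1}" using y' by blast
    fix r assume "r \<in> {cap_area v / cap_area 0 |v. norm v = 1}"
    then obtain v where "r = cap_area v / cap_area 0" "norm v = 1" by blast
    moreover from this have "v \<noteq> 0" by auto
    ultimately show "m / cap_area 0 \<le> r" using le cap_area_nonneg by (simp add: divide_right_mono)
  qed
qed

end

section \<open>From the depth of a query point to caps at the origin\<close>

lemma measure_translated_cap:
  fixes a :: "nat \<Rightarrow> real^2" and c :: "nat \<Rightarrow> real" and q :: "real^2"
  assumes pos: "\<And>i. i < n \<Longrightarrow> 0 < c i - a i \<bullet> q"
    and u: "\<And>i. i < n \<Longrightarrow> u i = (1 / (c i - a i \<bullet> q)) *\<^sub>R a i"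
  shows "{z. (\<forall>i<n. a i \<bullet> z < c i) \<and> 0 \<le> v \<bullet> (z - q)}
    = (+) q ` {z. (\<forall>i<n. u i \<bullet> z < 1) \<and> 0 \<le> v \<bullet> z}"
proof -
  have *: "u i \<bullet> y < 1 \<longleftrightarrow> a i \<bullet> (q + y) < c i" if "i < n" for i y
    using pos[OF that] by (auto simp: u[OF that] divide_less_eq inner_add_right)
  show ?thesis
  proof (intro equalityI subsetI)
    fix z assume z: "z \<in> {z. (\<forall>i<n. a i \<bullet> z < c i) \<and> 0 \<le> v \<bullet> (z - q)}"
    then have "z - q \<in> {z. (\<forall>i<n. u i \<bullet> z < 1) \<and> 0 \<le> v \<bullet> z}" using * by simp
    moreover have "z = q + (z - q)" by simp
    ultimately show "z \<in> (+) q ` {z. (\<forall>i<n. u i \<bullet> z < 1) \<and> 0 \<le> v \<bullet> z}" by blast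
  qed (use * in auto)
qed

text \<open>For \<open>q\<close> inside, all \<open>c i - a i \<bullet> q\<close> are positive;
  translating by \<open>- q\<close> and dividing by them gives the polar form, and translation
  preserves areas.\<close>

lemma halfspace_depth_eq:
  fixes a :: "nat \<Rightarrow> real^2" and c :: "nat \<Rightarrow> real" and q :: "real^2"
  assumes K: "K = {z. \<forall>i<n. a i \<bullet> z < c i}" "bounded K" and nz: "\<And>i. i < n \<Longrightarrow> a i \<noteq> 0"
    and pos: "\<And>i. i < n \<Longrightarrow> 0 < c i - a i \<bullet> q"
    and u: "\<And>i. i < n \<Longrightarrow> u i = (1 / (c i - a i \<bullet> q)) *\<^sub>R a i"
  shows "polar_polygon u n"
    "halfspace_depth K q = Inf {polar_polygon.cap_area u n v / polar_polygon.cap_area u n 0 |v. norm v = 1}"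
proof -
  note eq = measure_translated_cap[of n c a q u, OF pos u]
  have K_eq: "{z \<in> K. 0 \<le> v \<bullet> (z - q)} = (+) q ` {z. (\<forall>i<n. u i \<bullet> z < 1) \<and> 0 \<le> v \<bullet> z}" for v
    using eq[of v] by (simp add: K(1))
  have "bounded ((+) (- q) ` K)" using K(2) by (rule bounded_translation)
  moreover have "(+) (- q) ` K = {z. \<forall>i<n. u i \<bullet> z < 1}"
    using K_eq[of 0] by (simp add: image_image)
  ultimately interpret polar_polygon u n
    using nz pos by unfold_locales (force simp: u)+
  show "polar_polygon u n" by unfold_locales
  have m: "measure lebesgue {z \<in> K. 0 \<le> v \<bullet> (z - q)} = cap_area v" for v
    unfolding K_eq measure_translation cap_area_open ..
  from m[of 0] have "measure lebesgue K = cap_area 0" by simp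
  then show "halfspace_depth K q = Inf {cap_area v / cap_area 0 |v. norm v = 1}"
    unfolding halfspace_depth_def m by simp
qed

text \<open>The violated constraint is the normal of a halfplane at \<open>q\<close> that misses
  \<open>K\<close>, so the infimum 0 is attained.\<close>

lemma halfspace_depth_outside:
  fixes a q :: "real^2"
  assumes "K \<subseteq> {z. a \<bullet> z < c}" "a \<noteq> 0" "c \<le> a \<bullet> q"
  shows "halfspace_depth K q = 0"
proof -
  let ?v = "(1 / norm a) *\<^sub>R a"
  have "?v \<bullet> (z - q) < 0" if "z \<in> K" for z
  proof -
    have "a \<bullet> (z - q) < 0" using assms(1,3) that by (auto simp: inner_diff_right)
    then show ?thesis using assms(2) by (simp add: divide_neg_pos)
  qed
  then have "{z \<in> K. 0 \<le> ?v \<bullet> (z - q)} = {}" by (auto simp: not_le)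
  then have "0 = measure lebesgue {z \<in> K. 0 \<le> ?v \<bullet> (z - q)} / measure lebesgue K"
    by (simp only:) simp
  moreover have "norm ?v = 1" using assms(2) by simp
  ultimately have "0 \<in> {measure lebesgue {z \<in> K. v \<bullet> (z - q) \<ge> 0} / measure lebesgue K |v. norm v = 1}"
    by blast
  then show ?thesis unfolding halfspace_depth_def
    by (intro cInf_eq_minimum) auto
qed

section \<open>The query program\<close>

declare One_nat_def [simp del]

text \<open>\<open>clip\<close> intersects the interval from \<open>rvar 5\<close> to \<open>rvar 6\<close> with the solutions \<open>\<tau>\<close> of
  \<open>\<tau> * rvar 7 \<le> rvar 8\<close>. The empty interval \<open>{1..0}\<close> stays empty under further clipping.\<close>

definition clip :: com where
  "clip = Cond (RLess (RConst 0) (RVar 7))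
     (Cond (RLess (RDiv (RVar 8) (RVar 7)) (RVar 6)) (RAssign 6 (RDiv (RVar 8) (RVar 7))) Skip)
     (Cond (RLess (RVar 7) (RConst 0))
       (Cond (RLess (RVar 5) (RDiv (RVar 8) (RVar 7))) (RAssign 5 (RDiv (RVar 8) (RVar 7))) Skip)
       (Cond (RLess (RVar 8) (RConst 0)) (Seq (RAssign 5 (RConst 1)) (RAssign 6 (RConst 0))) Skip))"

text \<open>Only the interval as a set is specified, since an empty interval has many pairs of end
  points.\<close>

lemma run_clip:
  assumes Q: "\<And>lo hi. {lo..hi} = {rvar s 5..rvar s 6} \<inter> {\<tau>. \<tau> * rvar s 7 \<le> rvar s 8} \<Longrightarrow>
    Q (s\<lparr>rvar := (rvar s)(5 := lo, 6 := hi)\<rparr>)"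
  shows "run m clip s Q"
proof -
  have same: "s = s\<lparr>rvar := (rvar s)(5 := rvar s 5, 6 := rvar s 6)\<rparr>" by simp
  have upd5: "s\<lparr>rvar := (rvar s)(5 := x)\<rparr> = s\<lparr>rvar := (rvar s)(5 := x, 6 := rvar s 6)\<rparr>" for x
    by (simp add: fun_upd_def) (auto intro!: arg_cong[where f = "\<lambda>r. s\<lparr>rvar := r\<rparr>"])
  have upd6: "s\<lparr>rvar := (rvar s)(6 := x)\<rparr> = s\<lparr>rvar := (rvar s)(5 := rvar s 5, 6 := x)\<rparr>" for x
    by simp
  have pos: "\<tau> * rvar s 7 \<le> rvar s 8 \<longleftrightarrow> \<tau> \<le> rvar s 8 / rvar s 7" if "0 < rvar s 7" for \<tau>
    using that by (simp add: pos_le_divide_eq)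
  have neg: "\<tau> * rvar s 7 \<le> rvar s 8 \<longleftrightarrow> rvar s 8 / rvar s 7 \<le> \<tau>" if "rvar s 7 < 0" for \<tau>
    using that by (simp add: neg_divide_le_eq)
  show ?thesis
    unfolding clip_def
  proof (intro run_Cond run_RAssign run_Seq run_Skip)
    assume "bval (RLess (RConst 0) (RVar 7)) s" "bval (RLess (RDiv (RVar 8) (RVar 7)) (RVar 6)) s"
    then show "Q (s\<lparr>rvar := (rvar s)(6 := rval (RDiv (RVar 8) (RVar 7)) s)\<rparr>)"
      by (subst upd6) (intro Q, auto simp: pos)
  next
    assume "bval (RLess (RConst 0) (RVar 7)) s" "\<not> bval (RLess (RDiv (RVar 8) (RVar 7)) (RVar 6)) s"
    then show "Q s"
      by (subst same) (intro Q, auto simp: pos)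
  next
    assume "bval (RLess (RVar 7) (RConst 0)) s" "bval (RLess (RVar 5) (RDiv (RVar 8) (RVar 7))) s"
    then show "Q (s\<lparr>rvar := (rvar s)(5 := rval (RDiv (RVar 8) (RVar 7)) s)\<rparr>)"
      by (subst upd5) (intro Q, auto simp: neg)
  next
    assume "bval (RLess (RVar 7) (RConst 0)) s" "\<not> bval (RLess (RVar 5) (RDiv (RVar 8) (RVar 7))) s"
    then show "Q s"
      by (subst same) (intro Q, auto simp: neg)
  next
    assume "\<not> bval (RLess (RConst 0) (RVar 7)) s" "\<not> bval (RLess (RVar 7) (RConst 0)) s"
      and "bval (RLess (RVar 8) (RConst 0)) s"
    then show "Q ((s\<lparr>rvar := (rvar s)(5 := rval (RConst 1) s)\<rparr>)
      \<lparr>rvar := (rvar (s\<lparr>rvar := (rvar s)(5 := rval (RConst 1) s)\<rparr>))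
        (6 := rval (RConst 0) (s\<lparr>rvar := (rvar s)(5 := rval (RConst 1) s)\<rparr>))\<rparr>)"
      by simp (intro Q, auto)
  next
    assume "\<not> bval (RLess (RConst 0) (RVar 7)) s" "\<not> bval (RLess (RVar 7) (RConst 0)) s"
      and "\<not> bval (RLess (RVar 8) (RConst 0)) s"
    then show "Q s"
      by (subst same) (intro Q, auto)
  qed
qed

text \<open>The edge line \<open>i\<close> lies in the halfplane \<open>k\<close> exactly for the parameters \<open>\<tau>\<close> with
  \<open>\<tau> * rvar 7 \<le> rvar 8\<close>; here \<open>i\<close> is \<open>ivar 3\<close> and \<open>k\<close> is \<open>ivar 5\<close>.\<close>

definition edge_constraint :: com where
  "edge_constraint = Seq
     (RAssign 7 (RSub (RMul (RRead 2 (IVar 5)) (RRead 1 (IVar 3))) (RMul (RRead 1 (IVar 5)) (RRead 2 (IVar 3)))))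
     (RAssign 8 (RSub
       (RAdd (RMul (RRead 1 (IVar 3)) (RRead 1 (IVar 3))) (RMul (RRead 2 (IVar 3)) (RRead 2 (IVar 3))))
       (RAdd (RMul (RRead 1 (IVar 5)) (RRead 1 (IVar 3))) (RMul (RRead 2 (IVar 5)) (RRead 2 (IVar 3))))))"

text \<open>An earlier normal \<open>k\<close> that equals the normal \<open>i\<close> must make the edge \<open>i\<close> empty, so that repeated
  halfplanes are counted once.\<close>

definition skip_repeated :: com where
  "skip_repeated = Cond
     (BAnd (ILess (IVar 5) (IVar 3)) (BAnd (BNot (RLess (RVar 7) (RConst 0)))
       (BAnd (BNot (RLess (RConst 0) (RVar 7))) (BNot (RLess (RConst 0) (RVar 8))))))
     (RAssign 8 (RConst (- 1))) Skip"

text \<open>The first loop computes a bound for the coordinates of the edge, from which the second one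
  starts clipping.\<close>

definition compute_edge :: com where
  "compute_edge =
     Seq (RAssign 9 (RConst 0))
    (Seq (For 5 (IVar 1) (Seq edge_constraint
       (RAssign 9 (RAdd (RVar 9) (RAdd (RConst 1)
         (RMul (RDiv (RVar 8) (RVar 7)) (RDiv (RVar 8) (RVar 7))))))))
    (Seq (RAssign 5 (RSub (RConst 0) (RVar 9)))
    (Seq (RAssign 6 (RVar 9))
    (Seq (For 5 (IVar 1) (Seq edge_constraint (Seq skip_repeated clip)))
    (Seq (RWrite 3 (IVar 3) (RVar 5)) (RWrite 4 (IVar 3) (RVar 6)))))))"

text \<open>Leaves twice the area of the cap with normal \<open>(rvar 3, rvar 4)\<close> in \<open>rvar 10\<close>.\<close>

definition compute_cap :: com where
  "compute_cap =
     Seq (RAssign 10 (RConst 0))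
    (For 5 (IVar 1)
      (Seq (RAssign 5 (RRead 3 (IVar 5)))
      (Seq (RAssign 6 (RRead 4 (IVar 5)))
      (Seq (RAssign 7 (RSub (RMul (RVar 3) (RRead 2 (IVar 5))) (RMul (RVar 4) (RRead 1 (IVar 5)))))
      (Seq (RAssign 8 (RAdd (RMul (RVar 3) (RRead 1 (IVar 5))) (RMul (RVar 4) (RRead 2 (IVar 5)))))
      (Seq clip
      (Cond (RLess (RVar 5) (RVar 6))
        (RAssign 10 (RAdd (RVar 10) (RDiv (RSub (RVar 6) (RVar 5))
          (RAdd (RMul (RRead 1 (IVar 5)) (RRead 1 (IVar 5))) (RMul (RRead 2 (IVar 5)) (RRead 2 (IVar 5)))))))
        Skip)))))))"

definition minimize :: com where
  "minimize =
     For 3 (IAdd (IVar 1) (IVar 1)) (For 4 (IAdd (IVar 1) (IVar 1))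
      (Seq (RAssign 3 (RAdd (RRead 1 (IVar 3)) (RRead 1 (IVar 4))))
      (Seq (RAssign 4 (RAdd (RRead 2 (IVar 3)) (RRead 2 (IVar 4))))
      (Seq compute_cap
      (Cond (RLess (RVar 10) (RVar 11)) (RAssign 11 (RVar 10)) Skip)))))"

definition compute_depth :: com where
  "compute_depth =
     Seq (For 3 (IVar 1) compute_edge)
    (Seq (RAssign 3 (RConst 0))
    (Seq (RAssign 4 (RConst 0))
    (Seq compute_cap
    (Seq (RAssign 11 (RVar 10))
    (Seq (RAssign 12 (RVar 10))
    (Seq minimize
    (RAssign 0 (RDiv (RVar 11) (RVar 12)))))))))"

text \<open>Stores the normals in the coordinates centred at \<open>q\<close>, followed by their negatives; \<open>ivar 2\<close>
  reports that \<open>q\<close> is outside.\<close>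

definition compute_normals :: com where
  "compute_normals =
     Seq (IAssign 2 (IConst 0))
    (For 3 (IVar 1)
      (Seq (RAssign 2 (RSub (RRead 0 (IAdd (IVar 1) (IAdd (IVar 1) (IVar 3))))
        (RAdd (RMul (RRead 0 (IVar 3)) (RVar 0)) (RMul (RRead 0 (IAdd (IVar 1) (IVar 3))) (RVar 1)))))
      (Cond (RLess (RConst 0) (RVar 2))
        (Seq (RWrite 1 (IVar 3) (RDiv (RRead 0 (IVar 3)) (RVar 2)))
        (Seq (RWrite 1 (IAdd (IVar 1) (IVar 3)) (RSub (RConst 0) (RDiv (RRead 0 (IVar 3)) (RVar 2))))
        (Seq (RWrite 2 (IVar 3) (RDiv (RRead 0 (IAdd (IVar 1) (IVar 3))) (RVar 2)))
        (RWrite 2 (IAdd (IVar 1) (IVar 3)) (RSub (RConst 0) (RDiv (RRead 0 (IAdd (IVar 1) (IVar 3))) (RVar 2)))))))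
        (IAssign 2 (IConst 1)))))"

definition query :: com where
  "query = Seq compute_normals (Cond (ILess (IConst 0) (IVar 2)) (RAssign 0 (RConst 0)) compute_depth)"

section \<open>Correctness of the query program\<close>

context polar_polygon
begin

definition normals_stored :: "state \<Rightarrow> bool" where
  "normals_stored s \<longleftrightarrow> ivar s 1 = n \<and>
     (\<forall>i<2 * n. rarr s 1 i = signed_normal i $ 1 \<and> rarr s 2 i = signed_normal i $ 2)"

definition edges_stored :: "nat \<Rightarrow> state \<Rightarrow> bool" where
  "edges_stored l s \<longleftrightarrow> (\<forall>i<l. edge i = {rarr s 3 i..rarr s 4 i})"

lemma normals_stored_upd [simp]:
  "normals_stored (s\<lparr>rvar := r\<rparr>) = normals_stored s"
  "f 1 = ivar s 1 \<Longrightarrow> normals_stored (s\<lparr>ivar := f\<rparr>) = normals_stored s"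
  "edges_stored l (s\<lparr>rvar := r\<rparr>) = edges_stored l s"
  "edges_stored l (s\<lparr>ivar := f\<rparr>) = edges_stored l s"
  by (auto simp: normals_stored_def edges_stored_def)

lemma normals_storedD:
  assumes "normals_stored s" "i < n"
  shows "rarr s 1 i = u i $ 1" "rarr s 2 i = u i $ 2"
  using assms by (auto simp: normals_stored_def)

definition slope :: "nat \<Rightarrow> nat \<Rightarrow> real" where
  "slope i k = u k \<bullet> rot (u i)"

definition offset :: "nat \<Rightarrow> nat \<Rightarrow> real" where
  "offset i k = u i \<bullet> u i - u k \<bullet> u i"

lemma inner_edge_point_le_1:
  assumes "i < n"
  shows "u k \<bullet> edge_point i \<tau> \<le> 1 \<longleftrightarrow> \<tau> * slope i k \<le> offset i k"
proof -
  have "0 < u i \<bullet> u i" using nonzero[OF assms] by simp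
  then show ?thesis
    by (simp add: edge_point_def slope_def offset_def inner_add_right divide_le_eq del: inner_gt_zero_iff)
      (simp add: algebra_simps)
qed

text \<open>Boundedness yields one constraint of positive and one of negative slope, whose quotients
  bound the edge on both sides. Clipping may therefore start from a finite interval.\<close>

lemma edge_eq:
  assumes i: "i < n" and B: "\<And>k. k < n \<Longrightarrow> \<bar>offset i k / slope i k\<bar> \<le> B"
  shows "edge i = {- B..B} \<inter> {\<tau>. \<forall>k<n. \<tau> * slope i k \<le> offset i k \<and> \<not> (k < i \<and> u k = u i)}"
proof -
  have rot: "rot (u i) \<noteq> 0" using nonzero[OF i] by (auto simp: vec2_eq_iff)
  obtain k where k: "k < n" "0 < slope i k"
    using ex_inner_pos[OF rot] by (auto simp: slope_def)
  obtain l where l: "l < n" "slope i l < 0"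
    using ex_inner_pos[of "- rot (u i)"] rot by (auto simp: slope_def)
  have "- B \<le> \<tau> \<and> \<tau> \<le> B" if "\<forall>k<n. \<tau> * slope i k \<le> offset i k" for \<tau>
  proof -
    have "\<tau> \<le> offset i k / slope i k" "offset i l / slope i l \<le> \<tau>"
      using that k l by (simp_all add: pos_le_divide_eq neg_divide_le_eq)
    then show ?thesis using B[OF k(1)] B[OF l(1)] by linarith
  qed
  moreover have "first_index i \<longleftrightarrow> (\<forall>k<n. \<not> (k < i \<and> u k = u i))"
    using i by (auto simp: first_index_def)
  ultimately show ?thesis
    by (auto simp: edge_def body_def inner_edge_point_le_1[OF i])
qed

lemma run_edge_constraint:
  assumes "normals_stored s" "ivar s 3 = i" "ivar s 5 = k" "i < n" "k < n"
    and "Q (s\<lparr>rvar := (rvar s)(7 := slope i k, 8 := offset i k)\<rparr>)"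
  shows "run m edge_constraint s Q"
proof -
  note st = normals_storedD[OF assms(1,4)] normals_storedD[OF assms(1,5)]
  have "slope i k = u k $ 2 * u i $ 1 - u k $ 1 * u i $ 2"
    "offset i k = u i $ 1 * u i $ 1 + u i $ 2 * u i $ 2 - (u k $ 1 * u i $ 1 + u k $ 2 * u i $ 2)"
    by (simp_all add: slope_def offset_def inner_vec2)
  with assms(6) show ?thesis
    unfolding edge_constraint_def by (intro run_Seq run_RAssign) (simp add: assms st)
qed

lemma run_skip_repeated:
  assumes "ivar s 3 = i" "ivar s 5 = k" "rvar s 7 = slope i k" "rvar s 8 = offset i k" "i < n"
    and "\<And>y. {\<tau>. \<tau> * slope i k \<le> y} = {\<tau>. \<tau> * slope i k \<le> offset i k \<and> \<not> (k < i \<and> u k = u i)} \<Longrightarrow>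
      Q (s\<lparr>rvar := (rvar s)(8 := y)\<rparr>)"
  shows "run m skip_repeated s Q"
proof -
  have same: "s = s\<lparr>rvar := (rvar s)(8 := offset i k)\<rparr>" by (simp add: assms(4)[symmetric])
  \<comment> \<open>Slope and offset compare the coordinates of \<open>u k\<close> and
    \<open>u i\<close> in the orthogonal basis \<open>u i\<close>, \<open>rot (u i)\<close>.\<close>
  have eq: "u k = u i" if "slope i k = 0" "offset i k = 0"
  proof -
    have "(u i \<bullet> u i) *\<^sub>R u k = (u i \<bullet> u k) *\<^sub>R u i + slope i k *\<^sub>R rot (u i)"
      by (simp add: vec2_eq_iff inner_vec2 slope_def algebra_simps)
    then have "(u i \<bullet> u i) *\<^sub>R u k = (u i \<bullet> u i) *\<^sub>R u i"
      using that by (simp add: offset_def inner_commute)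
    then show ?thesis using nonzero[OF assms(5)] by simp
  qed
  have eq': "slope i k = 0" "offset i k = 0" if "u k = u i"
    using that by (simp_all add: slope_def offset_def inner_vec2)
  show ?thesis
    unfolding skip_repeated_def
  proof (intro run_Cond run_RAssign run_Skip)
    assume "bval (BAnd (ILess (IVar 5) (IVar 3)) (BAnd (BNot (RLess (RVar 7) (RConst 0)))
       (BAnd (BNot (RLess (RConst 0) (RVar 7))) (BNot (RLess (RConst 0) (RVar 8)))))) s"
    \<comment> \<open>Offset 0 means a repetition. With a negative offset the constraint was
      unsatisfiable already, so the value -1 changes nothing.\<close>
    then have *: "k < i" "slope i k = 0" "offset i k \<le> 0" by (auto simp: assms)
    then show "Q (s\<lparr>rvar := (rvar s)(8 := rval (RConst (- 1)) s)\<rparr>)"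
      by (intro assms(6)) (use eq in auto)
  next
    assume "\<not> bval (BAnd (ILess (IVar 5) (IVar 3)) (BAnd (BNot (RLess (RVar 7) (RConst 0)))
       (BAnd (BNot (RLess (RConst 0) (RVar 7))) (BNot (RLess (RConst 0) (RVar 8)))))) s"
    then show "Q s"
      by (subst same) (intro assms(6), use eq' in \<open>auto simp: assms\<close>)
  qed
qed

lemma run_compute_edge:
  assumes "n \<le> m" and i: "i < n" and s: "normals_stored s" "edges_stored i s" "ivar s 3 = i"
    and Q: "\<And>s'. normals_stored s' \<Longrightarrow> edges_stored (Suc i) s' \<Longrightarrow> ivar s' 3 = i \<Longrightarrow> Q s'"
  shows "run m compute_edge s Q"
proof -
  define I1 where "I1 k s \<longleftrightarrow> normals_stored s \<and> edges_stored i s \<and> ivar s 3 = i \<and> ivar s 5 = k \<and>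
    0 \<le> rvar s 9 \<and> (\<forall>j<k. \<bar>offset i j / slope i j\<bar> \<le> rvar s 9)" for k s
  define I2 where "I2 B k s \<longleftrightarrow> normals_stored s \<and> edges_stored i s \<and> ivar s 3 = i \<and> ivar s 5 = k \<and>
    {rvar s 5..rvar s 6} = {- B..B} \<inter>
      {\<tau>. \<forall>j<k. \<tau> * slope i j \<le> offset i j \<and> \<not> (j < i \<and> u j = u i)}" for B k s
  \<comment> \<open>Summing these terms dominates every quotient without comparisons; a quotient
    with slope 0 is 0 and does no harm.\<close>
  have bound: "\<bar>x\<bar> \<le> 1 + x * x" for x :: real
    using zero_le_power2[of "\<bar>x\<bar> - 1"] zero_le_square[of x] by (simp add: power2_eq_square algebra_simps)
  show ?thesis
    unfolding compute_edge_def
  proof (intro run_Seq run_RAssign, rule run_For[where l = n and I = I1])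
    show "n \<le> m" by fact
  next
    show "I1 0 ((s\<lparr>rvar := (rvar s)(9 := rval (RConst 0) s)\<rparr>)
      \<lparr>ivar := (ivar (s\<lparr>rvar := (rvar s)(9 := rval (RConst 0) s)\<rparr>))(5 := 0)\<rparr>)"
      using s by (simp add: I1_def)
  next
    fix k s assume "I1 k s"
    then show "ivar s 5 = k \<and> ival (IVar 1) s = n" by (simp add: I1_def normals_stored_def)
  next
    fix k s assume k: "k < n" and I: "I1 k s"
    let ?o = "offset i k / slope i k"
    have "\<bar>offset i j / slope i j\<bar> \<le> rvar s 9 + (1 + ?o * ?o)" if "j < Suc k" for j
    proof (cases "j = k")
      case True
      then show ?thesis using bound[of ?o] I by (simp add: I1_def)
    next
      case False
      then have "\<bar>offset i j / slope i j\<bar> \<le> rvar s 9" using I that by (simp add: I1_def)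
      then show ?thesis using zero_le_square[of ?o] by linarith
    qed
    then show "run m (Seq edge_constraint (RAssign 9 (RAdd (RVar 9) (RAdd (RConst 1)
         (RMul (RDiv (RVar 8) (RVar 7)) (RDiv (RVar 8) (RVar 7))))))) s
       (\<lambda>s'. ivar s' 5 = k \<and> I1 (Suc k) (s'\<lparr>ivar := (ivar s')(5 := Suc k)\<rparr>))"
      using I k i by (intro run_Seq run_edge_constraint[of _ i k] run_RAssign) (simp_all add: I1_def)
  next
    fix s assume I: "I1 n s"
    define B where "B = rvar s 9"
    have edge: "edge i = {- B..B} \<inter> {\<tau>. \<forall>k<n. \<tau> * slope i k \<le> offset i k \<and> \<not> (k < i \<and> u k = u i)}"
      using I by (intro edge_eq[OF i]) (simp add: I1_def B_def)
    let ?s = "s\<lparr>rvar := (rvar s)(5 := - B, 6 := B)\<rparr>"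
    have "run m (For 5 (IVar 1) (Seq edge_constraint (Seq skip_repeated clip))) ?s
      (\<lambda>s. run m (Seq (RWrite 3 (IVar 3) (RVar 5)) (RWrite 4 (IVar 3) (RVar 6))) s Q)"
    proof (rule run_For[where l = n and I = "I2 B"])
      show "n \<le> m" by fact
      show "I2 B 0 (?s\<lparr>ivar := (ivar ?s)(5 := 0)\<rparr>)" using I by (simp add: I2_def I1_def)
    next
      fix k s assume "I2 B k s"
      then show "ivar s 5 = k \<and> ival (IVar 1) s = n" by (simp add: I2_def normals_stored_def)
    next
      fix k s assume k: "k < n" and I: "I2 B k s"
      show "run m (Seq edge_constraint (Seq skip_repeated clip)) s
        (\<lambda>s'. ivar s' 5 = k \<and> I2 B (Suc k) (s'\<lparr>ivar := (ivar s')(5 := Suc k)\<rparr>))"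
      proof (intro run_Seq run_edge_constraint[of _ i k] run_skip_repeated[of _ i k] run_clip)
        fix y lo hi
        let ?s1 = "s\<lparr>rvar := (rvar s)(7 := slope i k, 8 := offset i k)\<rparr>"
        let ?s2 = "?s1\<lparr>rvar := (rvar ?s1)(8 := y)\<rparr>"
        let ?s3 = "?s2\<lparr>rvar := (rvar ?s2)(5 := lo, 6 := hi)\<rparr>"
        assume y: "{\<tau>. \<tau> * slope i k \<le> y} = {\<tau>. \<tau> * slope i k \<le> offset i k \<and> \<not> (k < i \<and> u k = u i)}"
          and "{lo..hi} = {rvar ?s2 5..rvar ?s2 6} \<inter> {\<tau>. \<tau> * rvar ?s2 7 \<le> rvar ?s2 8}"
        then have "{lo..hi} = {rvar s 5..rvar s 6} \<inter>
            {\<tau>. \<tau> * slope i k \<le> offset i k \<and> \<not> (k < i \<and> u k = u i)}" by simp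
        also have "\<dots> = {- B..B} \<inter>
            {\<tau>. \<forall>j<Suc k. \<tau> * slope i j \<le> offset i j \<and> \<not> (j < i \<and> u j = u i)}"
          using I unfolding I2_def less_Suc_eq by blast
        finally show "ivar ?s3 5 = k \<and> I2 B (Suc k) (?s3\<lparr>ivar := (ivar ?s3)(5 := Suc k)\<rparr>)"
          using I by (simp add: I2_def)
      qed (use I i k in \<open>simp_all add: I2_def\<close>)
    next
      fix s assume I: "I2 B n s"
      then have "{rvar s 5..rvar s 6} = edge i" by (simp add: I2_def edge)
      then show "run m (Seq (RWrite 3 (IVar 3) (RVar 5)) (RWrite 4 (IVar 3) (RVar 6))) s Q"
        using I by (intro run_Seq run_RWrite Q)
          (auto simp: I2_def normals_stored_def edges_stored_def less_Suc_eq)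
    qed
    then show "run m (Seq (RAssign 5 (RSub (RConst 0) (RVar 9))) (Seq (RAssign 6 (RVar 9))
      (Seq (For 5 (IVar 1) (Seq edge_constraint (Seq skip_repeated clip)))
        (Seq (RWrite 3 (IVar 3) (RVar 5)) (RWrite 4 (IVar 3) (RVar 6)))))) s Q"
      by (intro run_RAssign run_Seq) (simp add: B_def)
  qed
qed

lemma run_For_compute_edge:
  assumes "n \<le> m" and s: "normals_stored s"
    and Q: "\<And>s'. normals_stored s' \<Longrightarrow> edges_stored n s' \<Longrightarrow> Q s'"
  shows "run m (For 3 (IVar 1) compute_edge) s Q"
proof (rule run_For[where l = n and I = "\<lambda>i s. normals_stored s \<and> edges_stored i s \<and> ivar s 3 = i"])
  fix k s assume "k < n" "normals_stored s \<and> edges_stored k s \<and> ivar s 3 = k"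
  with assms(1) show "run m compute_edge s (\<lambda>s'. ivar s' 3 = k \<and>
      normals_stored (s'\<lparr>ivar := (ivar s')(3 := Suc k)\<rparr>) \<and>
      edges_stored (Suc k) (s'\<lparr>ivar := (ivar s')(3 := Suc k)\<rparr>) \<and>
      ivar (s'\<lparr>ivar := (ivar s')(3 := Suc k)\<rparr>) 3 = Suc k)"
    by (intro run_compute_edge[of m k]) auto
qed (use assms in \<open>auto simp: normals_stored_def edges_stored_def\<close>)

text \<open>For \<open>v = 0\<close> the clipping condition is trivially true, so the same code also
  yields the total area.\<close>

lemma run_compute_cap:
  assumes "n \<le> m" and s: "normals_stored s" "edges_stored n s" "v $ 1 = rvar s 3" "v $ 2 = rvar s 4"
    and Q: "\<And>s'. normals_stored s' \<Longrightarrow> edges_stored n s' \<Longrightarrow> rvar s' 10 = 2 * cap_area v \<Longrightarrow>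
      rvar s' 11 = rvar s 11 \<Longrightarrow> rvar s' 12 = rvar s 12 \<Longrightarrow>
      ivar s' 3 = ivar s 3 \<Longrightarrow> ivar s' 4 = ivar s 4 \<Longrightarrow> Q s'"
  shows "run m compute_cap s Q"
proof -
  define I where "I k s' \<longleftrightarrow> normals_stored s' \<and> edges_stored n s' \<and> ivar s' 5 = k \<and>
    rvar s' 10 = (\<Sum>i<k. 2 * measure lebesgue (sector v i)) \<and>
    rvar s' 3 = v $ 1 \<and> rvar s' 4 = v $ 2 \<and> rvar s' 11 = rvar s 11 \<and> rvar s' 12 = rvar s 12 \<and>
    ivar s' 3 = ivar s 3 \<and> ivar s' 4 = ivar s 4" for k s'
  show ?thesis
    unfolding compute_cap_def
  proof (intro run_Seq run_RAssign, rule run_For[where l = n and I = I])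
    show "n \<le> m" by fact
  next
    show "I 0 ((s\<lparr>rvar := (rvar s)(10 := rval (RConst 0) s)\<rparr>)
      \<lparr>ivar := (ivar (s\<lparr>rvar := (rvar s)(10 := rval (RConst 0) s)\<rparr>))(5 := 0)\<rparr>)"
      using s by (simp add: I_def)
  next
    fix k s assume "I k s"
    then show "ivar s 5 = k \<and> ival (IVar 1) s = n" by (simp add: I_def normals_stored_def)
  next
    fix k s' assume k: "k < n" and I: "I k s'"
    then have st: "rarr s' 1 k = u k $ 1" "rarr s' 2 k = u k $ 2"
      by (auto simp: I_def normals_storedD)
    have N: "u k $ 1 * u k $ 1 + u k $ 2 * u k $ 2 = u k \<bullet> u k" by (simp add: inner_vec2)
    let ?R = "v $ 1 * u k $ 2 - v $ 2 * u k $ 1" and ?S = "v $ 1 * u k $ 1 + v $ 2 * u k $ 2"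
    have edge: "{lo..hi} = edge k \<inter> {\<tau>. 0 \<le> v \<bullet> edge_point k \<tau>}"
      if "{lo..hi} = {rarr s' 3 k..rarr s' 4 k} \<inter> {\<tau>. \<tau> * ?R \<le> ?S}" for lo hi
    proof -
      have "0 < u k \<bullet> u k" using nonzero[OF k] by simp
      then have "0 \<le> v \<bullet> edge_point k \<tau> \<longleftrightarrow> \<tau> * ?R \<le> ?S" for \<tau>
        by (simp add: edge_point_def inner_add_right zero_le_divide_iff del: inner_gt_zero_iff)
          (simp add: inner_vec2 algebra_simps)
      then show ?thesis using that I k by (simp add: I_def edges_stored_def)
    qed
    show "run m (Seq (RAssign 5 (RRead 3 (IVar 5)))
      (Seq (RAssign 6 (RRead 4 (IVar 5)))
      (Seq (RAssign 7 (RSub (RMul (RVar 3) (RRead 2 (IVar 5))) (RMul (RVar 4) (RRead 1 (IVar 5)))))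
      (Seq (RAssign 8 (RAdd (RMul (RVar 3) (RRead 1 (IVar 5))) (RMul (RVar 4) (RRead 2 (IVar 5)))))
      (Seq clip
      (Cond (RLess (RVar 5) (RVar 6))
        (RAssign 10 (RAdd (RVar 10) (RDiv (RSub (RVar 6) (RVar 5))
          (RAdd (RMul (RRead 1 (IVar 5)) (RRead 1 (IVar 5))) (RMul (RRead 2 (IVar 5)) (RRead 2 (IVar 5)))))))
        Skip)))))) s'
      (\<lambda>s'. ivar s' 5 = k \<and> I (Suc k) (s'\<lparr>ivar := (ivar s')(5 := Suc k)\<rparr>))"
    proof (intro run_Seq run_RAssign run_clip run_Cond run_Skip, goal_cases)
      case (1 lo hi)
      have "{lo..hi} = edge k \<inter> {\<tau>. 0 \<le> v \<bullet> edge_point k \<tau>}"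
        by (rule edge) (use 1(1) I st in \<open>simp add: I_def\<close>)
      moreover have "lo < hi" using 1(2) by simp
      moreover note measure_sector[OF k, of v lo hi]
      ultimately
      have "2 * measure lebesgue (sector v k) = (hi - lo) / (u k \<bullet> u k)" by simp
      then show ?case using I by (simp add: I_def st N)
    next
      case (2 lo hi)
      have "{lo..hi} = edge k \<inter> {\<tau>. 0 \<le> v \<bullet> edge_point k \<tau>}"
        by (rule edge) (use 2(1) I st in \<open>simp add: I_def\<close>)
      moreover have "\<not> lo < hi" using 2(2) by simp
      moreover note measure_sector[OF k, of v lo hi]
      ultimately
      have "2 * measure lebesgue (sector v k) = 0" by simp
      then show ?case using I by (simp add: I_def)
    qed
  next
    fix s' assume "I n s'"
    then show "Q s'"
      by (intro Q) (auto simp: I_def cap_area_eq_sum sum_distrib_left)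
  qed
qed

text \<open>\<open>rvar 11\<close> remains a cap area throughout, so the final value is both
  attained and a lower bound, as identifying the infimum requires.\<close>

lemma run_minimize:
  assumes "2 * n \<le> m" and s: "normals_stored s" "edges_stored n s" "rvar s 11 = 2 * cap_area x"
    and Q: "\<And>s' y. rvar s' 11 = 2 * cap_area y \<Longrightarrow> (\<And>w. w \<in> candidates \<Longrightarrow> rvar s' 11 \<le> 2 * cap_area w) \<Longrightarrow>
      rvar s' 12 = rvar s 12 \<Longrightarrow> Q s'"
  shows "run m minimize s Q"
proof -
  let ?w = "\<lambda>i j. signed_normal i + signed_normal j"
  define base where "base s' \<longleftrightarrow> normals_stored s' \<and> edges_stored n s' \<and> rvar s' 12 = rvar s 12 \<and>
    (\<exists>y. rvar s' 11 = 2 * cap_area y)" for s'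
  define I where "I i s' \<longleftrightarrow> base s' \<and> ivar s' 3 = i \<and>
    (\<forall>k<i. \<forall>j<2 * n. rvar s' 11 \<le> 2 * cap_area (?w k j))" for i s'
  define J where "J i j s' \<longleftrightarrow> I i s' \<and> ivar s' 4 = j \<and>
    (\<forall>k<j. rvar s' 11 \<le> 2 * cap_area (?w i k))" for i j s'
  have bound: "ival (IAdd (IVar 1) (IVar 1)) s' = 2 * n" if "base s'" for s'
    using that by (simp add: base_def normals_stored_def)
  show ?thesis
    unfolding minimize_def
  proof (rule run_For[where l = "2 * n" and I = I])
    show "2 * n \<le> m" by fact
    show "I 0 (s\<lparr>ivar := (ivar s)(3 := 0)\<rparr>)"
      using s by (auto simp: I_def base_def)
  next
    fix k s assume "I k s"
    then show "ivar s 3 = k \<and> ival (IAdd (IVar 1) (IVar 1)) s = 2 * n"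
      using bound by (simp add: I_def)
  next
    fix i s' assume i: "i < 2 * n" and I: "I i s'"
    show "run m (For 4 (IAdd (IVar 1) (IVar 1))
      (Seq (RAssign 3 (RAdd (RRead 1 (IVar 3)) (RRead 1 (IVar 4))))
      (Seq (RAssign 4 (RAdd (RRead 2 (IVar 3)) (RRead 2 (IVar 4))))
      (Seq compute_cap
      (Cond (RLess (RVar 10) (RVar 11)) (RAssign 11 (RVar 10)) Skip))))) s'
      (\<lambda>s'. ivar s' 3 = i \<and> I (Suc i) (s'\<lparr>ivar := (ivar s')(3 := Suc i)\<rparr>))"
    proof (rule run_For[where l = "2 * n" and I = "J i"])
      show "2 * n \<le> m" by fact
      show "J i 0 (s'\<lparr>ivar := (ivar s')(4 := 0)\<rparr>)"
        using I by (auto simp: J_def I_def base_def)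
    next
      fix k s assume "J i k s"
      then show "ivar s 4 = k \<and> ival (IAdd (IVar 1) (IVar 1)) s = 2 * n"
        using bound by (simp add: I_def J_def)
    next
      fix j s' assume j: "j < 2 * n" and J: "J i j s'"
      then have st: "rarr s' 1 i = signed_normal i $ 1" "rarr s' 2 i = signed_normal i $ 2"
        "rarr s' 1 j = signed_normal j $ 1" "rarr s' 2 j = signed_normal j $ 2"
        and b: "normals_stored s'" "edges_stored n s'" "ivar s' 3 = i" "ivar s' 4 = j"
        using i by (auto simp: J_def I_def base_def normals_stored_def)
      show "run m (Seq (RAssign 3 (RAdd (RRead 1 (IVar 3)) (RRead 1 (IVar 4))))
        (Seq (RAssign 4 (RAdd (RRead 2 (IVar 3)) (RRead 2 (IVar 4))))
        (Seq compute_cap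
        (Cond (RLess (RVar 10) (RVar 11)) (RAssign 11 (RVar 10)) Skip)))) s'
        (\<lambda>s'. ivar s' 4 = j \<and> J i (Suc j) (s'\<lparr>ivar := (ivar s')(4 := Suc j)\<rparr>))"
      proof (intro run_Seq run_RAssign run_compute_cap[where v = "?w i j"] run_Cond run_Skip, goal_cases)
        case 1
        then show ?case using \<open>2 * n \<le> m\<close> by simp
      next
        case (6 s'')
        then have le: "rvar s'' 10 \<le> rvar s' 11" by simp
        have "rvar s'' 10 \<le> 2 * cap_area (?w i k)" if "k < j" for k
          using J that le by (force simp: J_def)
        moreover have "rvar s'' 10 \<le> 2 * cap_area (?w k l)" if "k < i" "l < 2 * n" for k l
          using J that le by (force simp: J_def I_def)
        ultimately show ?case
          using 6 J by (auto simp: J_def I_def base_def less_Suc_eq b)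
      next
        case (7 s'')
        then show ?case
          using J by (auto simp: J_def I_def base_def less_Suc_eq b)
      qed (simp_all add: b st)
    next
      fix s' assume "J i (2 * n) s'"
      then show "ivar s' 3 = i \<and> I (Suc i) (s'\<lparr>ivar := (ivar s')(3 := Suc i)\<rparr>)"
        by (auto simp: J_def I_def base_def less_Suc_eq)
    qed
  next
    fix s' assume I: "I (2 * n) s'"
    then obtain y where "rvar s' 11 = 2 * cap_area y" by (auto simp: I_def base_def)
    moreover have "rvar s' 11 \<le> 2 * cap_area w" if "w \<in> candidates" for w
      using that I by (auto simp: candidates_def I_def)
    ultimately show "Q s'" using I by (intro Q) (auto simp: I_def base_def)
  qed
qed

lemma run_compute_depth:
  assumes "2 * n \<le> m" "normals_stored s"
    and Q: "\<And>s'. rvar s' 0 = Inf {cap_area v / cap_area 0 |v. norm v = 1} \<Longrightarrow> Q s'"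
  shows "run m compute_depth s Q"
  unfolding compute_depth_def
proof (intro run_Seq run_For_compute_edge run_RAssign run_compute_cap[where v = 0]
    run_minimize[where x = 0] Q, goal_cases)
  case (12 s1 s2 s3 y)
  have "rvar s3 11 / rvar s3 12 = cap_area y / cap_area 0" using 12 by simp
  also have "\<dots> = Inf {cap_area v / cap_area 0 |v. norm v = 1}"
    using 12 by (intro cap_area_quotient_eq_Inf[of _ y]) force+
  finally show ?case by simp
qed (use assms in simp_all)

end

text \<open>A violated halfplane only sets the flag and the loop continues; hence stored entries are
  asserted just for positive denominators.\<close>

lemma run_compute_normals:
  fixes a :: "nat \<Rightarrow> real^2" and c :: "nat \<Rightarrow> real" and q :: "real^2"
  assumes "n \<le> m" and s: "ivar s 1 = n" "rvar s 0 = q $ 1" "rvar s 1 = q $ 2"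
      "\<And>i. i < n \<Longrightarrow> rarr s 0 i = a i $ 1" "\<And>i. i < n \<Longrightarrow> rarr s 0 (n + i) = a i $ 2"
      "\<And>i. i < n \<Longrightarrow> rarr s 0 (n + (n + i)) = c i"
    and Q: "\<And>s'. ivar s' 1 = n \<Longrightarrow> ivar s' 2 = 0 \<longleftrightarrow> (\<forall>i<n. 0 < c i - a i \<bullet> q) \<Longrightarrow>
      (\<And>i. i < n \<Longrightarrow> 0 < c i - a i \<bullet> q \<Longrightarrow>
        rarr s' 1 i = a i $ 1 / (c i - a i \<bullet> q) \<and> rarr s' 1 (n + i) = - (a i $ 1 / (c i - a i \<bullet> q)) \<and>
        rarr s' 2 i = a i $ 2 / (c i - a i \<bullet> q) \<and> rarr s' 2 (n + i) = - (a i $ 2 / (c i - a i \<bullet> q))) \<Longrightarrow>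
      Q s'"
  shows "run m compute_normals s Q"
proof -
  let ?w = "\<lambda>i. c i - a i \<bullet> q"
  define I where "I k s' \<longleftrightarrow> ivar s' 1 = n \<and> ivar s' 3 = k \<and> rvar s' 0 = q $ 1 \<and> rvar s' 1 = q $ 2 \<and>
    rarr s' 0 = rarr s 0 \<and> (ivar s' 2 = 0 \<longleftrightarrow> (\<forall>i<k. 0 < ?w i)) \<and>
    (\<forall>i<k. 0 < ?w i \<longrightarrow>
      rarr s' 1 i = a i $ 1 / ?w i \<and> rarr s' 1 (n + i) = - (a i $ 1 / ?w i) \<and>
      rarr s' 2 i = a i $ 2 / ?w i \<and> rarr s' 2 (n + i) = - (a i $ 2 / ?w i))" for k and s' :: state
  show ?thesis
    unfolding compute_normals_def
  proof (intro run_Seq run_IAssign, rule run_For[where l = n and I = I])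
    show "n \<le> m" by fact
  next
    fix k s' assume "I k s'"
    then show "ivar s' 3 = k \<and> ival (IVar 1) s' = n" by (simp add: I_def)
  next
    fix s' assume "I n s'"
    then show "Q s'" by (intro Q) (simp_all add: I_def)
  next
    fix k s' assume k: "k < n" and I: "I k s'"
    have w: "c k - (a k $ 1 * q $ 1 + a k $ 2 * q $ 2) = ?w k" by (simp add: inner_vec2)
    show "run m (Seq (RAssign 2 (RSub (RRead 0 (IAdd (IVar 1) (IAdd (IVar 1) (IVar 3))))
        (RAdd (RMul (RRead 0 (IVar 3)) (RVar 0)) (RMul (RRead 0 (IAdd (IVar 1) (IVar 3))) (RVar 1)))))
      (Cond (RLess (RConst 0) (RVar 2))
        (Seq (RWrite 1 (IVar 3) (RDiv (RRead 0 (IVar 3)) (RVar 2)))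
        (Seq (RWrite 1 (IAdd (IVar 1) (IVar 3)) (RSub (RConst 0) (RDiv (RRead 0 (IVar 3)) (RVar 2))))
        (Seq (RWrite 2 (IVar 3) (RDiv (RRead 0 (IAdd (IVar 1) (IVar 3))) (RVar 2)))
        (RWrite 2 (IAdd (IVar 1) (IVar 3)) (RSub (RConst 0) (RDiv (RRead 0 (IAdd (IVar 1) (IVar 3))) (RVar 2)))))))
        (IAssign 2 (IConst 1)))) s'
      (\<lambda>s'. ivar s' 3 = k \<and> I (Suc k) (s'\<lparr>ivar := (ivar s')(3 := Suc k)\<rparr>))"
    proof (intro run_Seq run_RAssign run_Cond run_RWrite run_IAssign, goal_cases)
      case 1
      then have "0 < ?w k" using I k by (simp add: I_def s inner_vec2)
      with 1 show ?case using I k by (auto simp: I_def less_Suc_eq s w)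
    next
      case 2
      then have "\<not> 0 < ?w k" using I k by (simp add: I_def s inner_vec2)
      with 2 show ?case using I k by (auto simp: I_def less_Suc_eq s)
    qed
  qed (use s in \<open>simp add: I_def\<close>)
qed

text \<open>The bound \<open>2 * n\<close> on iterations comes from the doubled list of
  normals.\<close>

lemma run_query:
  fixes a :: "nat \<Rightarrow> real^2" and c :: "nat \<Rightarrow> real" and q :: "real^2"
  assumes "2 * n \<le> m" and s: "ivar s 1 = n" "rvar s 0 = q $ 1" "rvar s 1 = q $ 2"
      "\<And>i. i < n \<Longrightarrow> rarr s 0 i = a i $ 1" "\<And>i. i < n \<Longrightarrow> rarr s 0 (n + i) = a i $ 2"
      "\<And>i. i < n \<Longrightarrow> rarr s 0 (n + (n + i)) = c i"
    and K: "K = {z. \<forall>i<n. a i \<bullet> z < c i}" "bounded K" and nz: "\<And>i. i < n \<Longrightarrow> a i \<noteq> 0"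
  shows "run m query s (\<lambda>s'. rvar s' 0 = halfspace_depth K q)"
  unfolding query_def
proof (intro run_Seq run_compute_normals[where n = n and q = q and a = a and c = c] run_Cond run_RAssign,
    goal_cases)
  case (8 s')
  then obtain i where i: "i < n" "c i \<le> a i \<bullet> q" by force
  have "halfspace_depth K q = 0"
    by (rule halfspace_depth_outside[of _ "a i" "c i"]) (use K(1) i nz in auto)
  then show ?case by simp
next
  case (9 s')
  then have pos: "0 < c i - a i \<bullet> q" if "i < n" for i using that by simp
  define u where "u i = (1 / (c i - a i \<bullet> q)) *\<^sub>R a i" for i
  note depth = halfspace_depth_eq[OF K nz pos u_def]
  interpret polar_polygon u n by (rule depth(1))
  have "normals_stored s'"
    unfolding normals_stored_def
  proof (intro conjI allI impI)
    show "ivar s' 1 = n" by (rule 9(1))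
  next
    fix i assume "i < 2 * n"
    then show "rarr s' 1 i = signed_normal i $ 1" "rarr s' 2 i = signed_normal i $ 2"
      using 9(3)[of i] 9(3)[of "i - n"] pos[of i] pos[of "i - n"]
      by (cases "i < n"; force simp: signed_normal_def u_def)+
  qed
  then show ?case
    by (intro run_compute_depth) (use assms(1) depth(2) in auto)
qed (use assms in simp_all)

section \<open>Preprocessing\<close>

text \<open>The data structure consists of the input packed into one block of reals, and of \<open>n\<close> dummy
  pointers by which the query learns \<open>n\<close>.\<close>

definition preprocessing :: com where
  "preprocessing =
     Seq (For 3 (IVar 0)
       (Seq (RWrite 0 (IAdd (IVar 0) (IVar 3)) (RRead 1 (IVar 3)))
       (RWrite 0 (IAdd (IVar 0) (IAdd (IVar 0) (IVar 3))) (RRead 2 (IVar 3)))))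
    (Seq (IAssign 1 (IVar 0)) (IAssign 0 (IAdd (IVar 1) (IAdd (IVar 1) (IVar 1)))))"

text \<open>The first coordinates stay in place. Index arithmetic has no division, so
  \<open>n\<close> is not read off the block length 3n but passed on as a length of its own.\<close>

lemma run_preprocessing:
  fixes hs :: "((real^2) \<times> real) list"
  defines "n \<equiv> length hs"
  assumes "n \<le> m"
  shows "run m preprocessing (prep_input hs) (\<lambda>s. ivar s 0 = n + (n + n) \<and> ivar s 1 = n \<and>
    iarr s 0 = (\<lambda>_. 0) \<and> (\<forall>i<n. rarr s 0 i = fst (hs ! i) $ 1 \<and> rarr s 0 (n + i) = fst (hs ! i) $ 2 \<and>
      rarr s 0 (n + (n + i)) = snd (hs ! i)))"
proof -
  define I where "I k s \<longleftrightarrow> ivar s 0 = n \<and> ivar s 3 = k \<and> iarr s 0 = (\<lambda>_. 0) \<and>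
    (\<forall>i<n. rarr s 0 i = fst (hs ! i) $ 1 \<and> rarr s 1 i = fst (hs ! i) $ 2 \<and> rarr s 2 i = snd (hs ! i)) \<and>
    (\<forall>i<k. rarr s 0 (n + i) = fst (hs ! i) $ 2 \<and> rarr s 0 (n + (n + i)) = snd (hs ! i))" for k and s :: state
  show ?thesis
    unfolding preprocessing_def
  proof (intro run_Seq, rule run_For[where l = n and I = I])
    show "n \<le> m" by fact
  next
    show "I 0 (prep_input hs\<lparr>ivar := (ivar (prep_input hs))(3 := 0)\<rparr>)"
      by (simp add: I_def prep_input_def n_def)
  next
    fix k s assume k: "k < n" and I: "I k s"
    show "run m (Seq (RWrite 0 (IAdd (IVar 0) (IVar 3)) (RRead 1 (IVar 3)))
       (RWrite 0 (IAdd (IVar 0) (IAdd (IVar 0) (IVar 3))) (RRead 2 (IVar 3)))) s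
       (\<lambda>s'. ivar s' 3 = k \<and> I (Suc k) (s'\<lparr>ivar := (ivar s')(3 := Suc k)\<rparr>))"
      by (intro run_Seq run_RWrite) (use I k in \<open>auto simp: I_def less_Suc_eq\<close>)
  next
    fix s assume "I n s"
    then show "run m (Seq (IAssign 1 (IVar 0)) (IAssign 0 (IAdd (IVar 1) (IAdd (IVar 1) (IVar 1))))) s
      (\<lambda>s. ivar s 0 = n + (n + n) \<and> ivar s 1 = n \<and>
        iarr s 0 = (\<lambda>_. 0) \<and> (\<forall>i<n. rarr s 0 i = fst (hs ! i) $ 1 \<and> rarr s 0 (n + i) = fst (hs ! i) $ 2 \<and>
        rarr s 0 (n + (n + i)) = snd (hs ! i)))"
      by (intro run_Seq run_IAssign) (simp add: I_def)
  qed (simp add: I_def)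
qed

section \<open>Absolute constants for time and size\<close>

lemma loop_depth_query: "loop_depth query = 3"
  by (simp add: query_def compute_normals_def compute_depth_def compute_edge_def compute_cap_def
      minimize_def clip_def edge_constraint_def skip_repeated_def For_def)

lemma loop_depth_preprocessing: "loop_depth preprocessing = 1"
  by (simp add: preprocessing_def For_def)

lemma prep_output_correct:
  fixes hs :: "((real^2) \<times> real) list"
  assumes "K = (\<Inter>h\<in>set hs. halfplane h)" "bounded K" "\<And>h. h \<in> set hs \<Longrightarrow> fst h \<noteq> 0" "n = length hs"
  obtains t D where "preprocesses preprocessing hs t D" "t \<le> wcost n preprocessing"
    "ds_size D = 4 * n + 2"
    "\<And>q. \<exists>u. answers query D q u (halfspace_depth K q) \<and> u \<le> wcost (2 * n) query"
proof -
  from run_preprocessing[of hs n] obtain t s where s: "exec preprocessing (prep_input hs) t s"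
    "t \<le> wcost n preprocessing" "ivar s 0 = n + (n + n)" "ivar s 1 = n" "iarr s 0 = (\<lambda>_. 0)"
    "\<And>i. i < n \<Longrightarrow> rarr s 0 i = fst (hs ! i) $ 1" "\<And>i. i < n \<Longrightarrow> rarr s 0 (n + i) = fst (hs ! i) $ 2"
    "\<And>i. i < n \<Longrightarrow> rarr s 0 (n + (n + i)) = snd (hs ! i)"
    unfolding run_def assms(4) by auto
  have K: "K = {z. \<forall>i<n. fst (hs ! i) \<bullet> z < snd (hs ! i)}"
    unfolding assms(1,4) by (auto simp: halfplane_def set_conv_nth)
  have nz: "fst (hs ! i) \<noteq> 0" if "i < n" for i using assms(3,4) that by simp
  have "run (2 * n) query (query_input (prep_output s) q) (\<lambda>s'. rvar s' 0 = halfspace_depth K q)" for q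
    by (rule run_query[where n = n and a = "\<lambda>i. fst (hs ! i)" and c = "\<lambda>i. snd (hs ! i)", OF _ _ _ _ _ _ _ K assms(2)])
      (simp_all add: query_input_def prep_output_def s nz)
  then have "\<exists>u. answers query (prep_output s) q u (halfspace_depth K q) \<and> u \<le> wcost (2 * n) query" for q
    unfolding run_def answers_def by blast
  \<comment> \<open>All dummy pointers are address 0, hence valid.\<close>
  moreover have "preprocesses preprocessing hs t (prep_output s)"
    unfolding preprocesses_def pointers_valid_def using s(1,5) by (auto simp: prep_output_def)
  moreover have "ds_size (prep_output s) = 4 * n + 2"
    using s(3,4) by (simp add: ds_size_def prep_output_def)
  ultimately show ?thesis using that s(2) by blast
qed

text \<open>Any point of \<open>K\<close> serves as origin. For one halfplane \<open>ln n\<close>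
  would be 0 and the time bound would fail.\<close>

lemma number_of_halfplanes_ge_2:
  assumes "K = (\<Inter>h\<in>set hs. halfplane h)" "bounded K" "K \<noteq> {}" "\<And>h. h \<in> set hs \<Longrightarrow> fst h \<noteq> 0"
  shows "2 \<le> length hs"
proof -
  have K: "K = {z. \<forall>i<length hs. fst (hs ! i) \<bullet> z < snd (hs ! i)}"
    unfolding assms(1) by (auto simp: halfplane_def set_conv_nth)
  obtain q where "q \<in> K" using assms(3) by blast
  then have pos: "0 < snd (hs ! i) - fst (hs ! i) \<bullet> q" if "i < length hs" for i
    using K that by simp
  interpret polar_polygon "\<lambda>i. (1 / (snd (hs ! i) - fst (hs ! i) \<bullet> q)) *\<^sub>R fst (hs ! i)" "length hs"
    by (rule halfspace_depth_eq(1)[OF K assms(2)]) (use assms(4) pos in auto)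
  show ?thesis by (rule n_ge_2)
qed

theorem mainTheorem5:
  "\<exists>(P :: com) (Q :: com) (C :: real).
     \<forall>(K :: (real^2) set) (hs :: ((real^2) \<times> real) list) (n :: nat).
       open_convex_polygon K \<and> given_by K hs \<and> n = length hs \<longrightarrow>
       (\<exists>D t. preprocesses P hs t D \<and>
          real t \<le> C * (real n * ln (real n)) \<and>
          real (ds_size D) \<le> C * real n \<and>
          (\<forall>q. \<exists>u. answers Q D q u (halfspace_depth K q) \<and>
             real u \<le> C * real n ^ 3))"
proof -
  let ?p = "real (wcost 1 preprocessing)" and ?q = "real (wcost 1 query)"
  \<comment> \<open>2 because \<open>ln n \<ge> 1/2\<close> for \<open>n \<ge> 2\<close>; 8 from the
    cube of the iteration bound 2n; 5 because 4n + 2 \<le> 5n.\<close>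
  let ?C = "2 * ?p + 8 * ?q + 5"
  show ?thesis
  proof (rule exI[of _ preprocessing], rule exI[of _ query], rule exI[of _ ?C], intro allI impI)
    fix K :: "(real^2) set" and hs :: "((real^2) \<times> real) list" and n :: nat
    assume "open_convex_polygon K \<and> given_by K hs \<and> n = length hs"
    then have K: "K = (\<Inter>h\<in>set hs. halfplane h)" "bounded K" "K \<noteq> {}" "\<And>h. h \<in> set hs \<Longrightarrow> fst h \<noteq> 0"
      and n: "n = length hs"
      by (auto simp: open_convex_polygon_def given_by_def)
    from number_of_halfplanes_ge_2[OF K] n have n2: "2 \<le> n" by simp
    from prep_output_correct[OF K(1,2,4) n] obtain t D where D: "preprocesses preprocessing hs t D"
      "t \<le> wcost n preprocessing" "ds_size D = 4 * n + 2"
      "\<And>q. \<exists>u. answers query D q u (halfspace_depth K q) \<and> u \<le> wcost (2 * n) query" by blast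
    have "wcost n preprocessing \<le> wcost 1 preprocessing * n"
      using wcost_le_power[of n preprocessing] n2 by (simp add: loop_depth_preprocessing)
    with D(2) have "t \<le> wcost 1 preprocessing * n" by (rule order_trans)
    then have "real t \<le> ?p * real n" by (metis of_nat_le_iff of_nat_mult)
    also have "\<dots> \<le> ?p * (2 * (real n * ln (real n)))"
    proof (intro mult_left_mono)
      have "1 / 2 \<le> ln (2 :: real)" using ln2_ge_two_thirds by simp
      also have "\<dots> \<le> ln (real n)" using n2 by simp
      finally show "real n \<le> 2 * (real n * ln (real n))" using n2 by simp
    qed simp
    also have "\<dots> \<le> ?C * (real n * ln (real n))"
      using n2 by (simp add: algebra_simps)
    finally have time: "real t \<le> ?C * (real n * ln (real n))" .
    have "real (ds_size D) \<le> 5 * real n" using D(3) n2 by simp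
    also have "\<dots> \<le> ?C * real n" by (intro mult_right_mono) simp_all
    finally have size: "real (ds_size D) \<le> ?C * real n" .
    have "wcost (2 * n) query \<le> wcost 1 query * (2 * n) ^ 3"
      using wcost_le_power[of "2 * n" query] n2 by (simp add: loop_depth_query)
    then have "real (wcost (2 * n) query) \<le> ?q * (2 * real n) ^ 3"
      by (metis of_nat_le_iff of_nat_mult of_nat_numeral of_nat_power)
    also have "\<dots> = 8 * ?q * real n ^ 3" by (simp add: power_mult_distrib)
    also have "\<dots> \<le> ?C * real n ^ 3" by (intro mult_right_mono) simp_all
    finally have "real u \<le> ?C * real n ^ 3" if "u \<le> wcost (2 * n) query" for u
      using that by (meson of_nat_le_iff order_trans)
    with D(4) have "\<forall>q. \<exists>u. answers query D q u (halfspace_depth K q) \<and> real u \<le> ?C * real n ^ 3"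
      by blast
    with D(1) time size show "\<exists>D t. preprocesses preprocessing hs t D \<and>
        real t \<le> ?C * (real n * ln (real n)) \<and>
        real (ds_size D) \<le> ?C * real n \<and>
        (\<forall>q. \<exists>u. answers query D q u (halfspace_depth K q) \<and> real u \<le> ?C * real n ^ 3)"
      by blast
  qed
qed

end
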